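(* With the notation of the context, for every $\epsilon>0$, every $p>4$ and every $w>0$, as $l,k\to\infty$ with $l/k\to w$ (and $m$ arbitrary with $1\le m\le\dim H_l$), $$\frac{\|u_{klm}\|_{L^p(D(1/h(w),\epsilon)\cap\Omega_{\mathrm{ball}})}}{\|u_{klm}\|_{L^p(\Omega_{\mathrm{ball}})}}\to0,$$ where $D(r,\epsilon)=\{x\in\mathbb{R}^d:\,||x|-r|\ge\epsilon\}$.
   Context: $L u=-\Delta u+\frac{c^2}{|x|^2}u$ on $\mathbb{R}^d$, $d\ge2$, $c\ge0$. Set $\nu_l=\sqrt{(l+\tfrac d2-1)^2+c^2}$. $J_\nu$ is the Bessel function of the first kind of order $\nu$ and $j_{\nu,k}$ its $k$-th positive zero. $H_l$ is the space of spherical harmonics of degree $l$ on $S^{d-1}$ and $\{Y_{lm}:1\le m\le\dim H_l\}$ is an orthonormal basis of $H_l$. $\Omega_{\mathrm{ball}}=\{|x|<1\}$. In spherical coordinates $x=r\xi$, the Dirichlet eigenfunctions of $L$ in the unit ball are $u_{klm}(r,\xi)=r^{1-d/2}J_{\nu_l}(j_{\nu_l,k}r)Y_{lm}(\xi)$, $k\ge1$, $l\ge0$. For $w>0$, $h(w)>1$ is the unique solution of $\sqrt{h^2-1}-\arccos(1/h)=\pi/w$. *)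

theory Defs
  imports "HOL-Analysis.Analysis"
begin

definition besselJ :: "real \<Rightarrow> real \<Rightarrow> real" where
  "besselJ \<nu> x = (\<Sum>n. (-1) ^ n / (fact n * Gamma (real n + \<nu> + 1)) * (x / 2) powr (2 * real n + \<nu>))"

definition bessel_zero :: "real \<Rightarrow> nat \<Rightarrow> real" where
  "bessel_zero \<nu> k = (THE z. 0 < z \<and> besselJ \<nu> z = 0 \<and>
      card {y. 0 < y \<and> y < z \<and> besselJ \<nu> y = 0} = k - 1)"

definition poly_fun :: "(('n::finite \<Rightarrow> nat) \<Rightarrow> real) \<Rightarrow> real^'n \<Rightarrow> real" where
  "poly_fun c x = (\<Sum>\<alpha>\<in>{\<alpha>. c \<alpha> \<noteq> 0}. c \<alpha> * (\<Prod>i\<in>UNIV. (x $ i) ^ \<alpha> i))"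

definition laplacian :: "(real^'n::finite \<Rightarrow> real) \<Rightarrow> real^'n \<Rightarrow> real" where
  "laplacian f x = (\<Sum>i\<in>UNIV. (deriv ^^ 2) (\<lambda>t. f (x + t *\<^sub>R axis i 1)) 0)"

text \<open>H_l: restrictions to the unit sphere of homogeneous harmonic polynomials of degree l.
  (Values off the sphere are irrelevant; a function is in H_l if it agrees on the sphere with such
  a polynomial.)\<close>
definition sph_harm :: "nat \<Rightarrow> (real^'n::finite \<Rightarrow> real) set" where
  "sph_harm l = {Y. \<exists>c :: ('n \<Rightarrow> nat) \<Rightarrow> real.
      finite {\<alpha>. c \<alpha> \<noteq> 0} \<and>
      (\<forall>\<alpha>. c \<alpha> \<noteq> 0 \<longrightarrow> (\<Sum>i\<in>UNIV. \<alpha> i) = l) \<and>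
      (\<forall>x. laplacian (poly_fun c) x = 0) \<and>
      (\<forall>x\<in>sphere 0 1. Y x = poly_fun c x)}"

definition nu_l :: "real \<Rightarrow> nat \<Rightarrow> nat \<Rightarrow> real" where
  "nu_l c d l = sqrt ((real l + real d / 2 - 1)\<^sup>2 + c\<^sup>2)"

definition u_eig :: "real \<Rightarrow> nat \<Rightarrow> nat \<Rightarrow> (real^'n::finite \<Rightarrow> real) \<Rightarrow> real^'n \<Rightarrow> real" where
  "u_eig c k l Y x = (let \<nu> = nu_l c CARD('n) l in
     norm x powr (1 - real CARD('n) / 2) * besselJ \<nu> (bessel_zero \<nu> k * norm x) * Y (x /\<^sub>R norm x))"

definition Lp_norm :: "real \<Rightarrow> (real^'n::finite) set \<Rightarrow> (real^'n \<Rightarrow> real) \<Rightarrow> real" where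
  "Lp_norm p A f = enn2real (\<integral>\<^sup>+ x\<in>A. ennreal (\<bar>f x\<bar> powr p) \<partial>lborel) powr (1 / p)"

definition hfun :: "real \<Rightarrow> real" where
  "hfun w = (THE h. 1 < h \<and> sqrt (h\<^sup>2 - 1) - arccos (1 / h) = pi / w)"

definition Dset :: "real \<Rightarrow> real \<Rightarrow> (real^'n::finite) set" where
  "Dset r \<epsilon> = {x. \<bar>norm x - r\<bar> \<ge> \<epsilon>}"

end

theory Submission
  imports Defs
begin

text \<open>In the variable \<open>s = ln (x / \<nu>)\<close> the Bessel function \<open>v s = J\<^sub>\<nu> (\<nu> e\<^sup>s)\<close> solves
  \<open>v'' = - \<nu>\<^sup>2 q v\<close> with \<open>q s = exp (2 * s) - 1\<close>, which has its turning point at \<open>s = 0\<close>. Sturm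
  comparison on the gaps between consecutive zeros shows that the \<open>k\<close>-th zero \<open>\<nu> exp (s\<^sub>k)\<close> satisfies
  \<open>\<nu> \<integral>\<^sub>0\<^bsup>s\<^sub>k\<^esup> sqrt q = k \<pi> + o(\<nu>)\<close>, so \<open>exp (s\<^sub>k)\<close> tends to \<open>h(w)\<close> and the turning point sits at
  radius \<open>1 / h(w)\<close> in the limit. Put \<open>h = \<nu> powr (- 2/3)\<close>. For \<open>- h / 6 \<le> s \<le> 0\<close>, convexity gives
  \<open>v \<ge> v 0 / 2\<close>. At distance \<open>\<delta>\<close> from the turning point, an energy argument on the left and a
  monotone quadratic form in \<open>(v, v')\<close> on the right give \<open>v = O(h powr (1/4) * v 0)\<close>.
  Separating the angular factor, the ratio of the Lp norms is \<open>O(h powr (1/4 - 1/p))\<close>, which tends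
  to 0 exactly because \<open>p > 4\<close>.\<close>

subsection \<open>Solutions at a turning point\<close>

text \<open>The limit 0 at \<open>at_bot\<close> serves as the initial value from which
  \<open>f\<close> increases. The energy arguments left of the turning point start this way.\<close>

lemma nonneg_of_deriv_nonneg_at_bot:
  fixes f f' :: "real \<Rightarrow> real"
  assumes "\<And>t. t \<le> b \<Longrightarrow> (f has_real_derivative f' t) (at t)"
    and "\<And>t. t \<le> b \<Longrightarrow> 0 \<le> f' t"
    and "(f \<longlongrightarrow> 0) at_bot"
  shows "0 \<le> f b"
proof -
  have "f t \<le> f b" if "t \<le> b" for t
    by (rule DERIV_nonneg_imp_nondecreasing[OF that]) (use assms(1,2) in blast)
  then have "eventually (\<lambda>t. f t \<le> f b) at_bot"
    by (auto simp: eventually_at_bot_linorder)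
  then show ?thesis
    using tendsto_upperbound[OF assms(3)] by simp
qed

text \<open>The conditions at \<open>at_bot\<close>, that is at \<open>x = 0\<close>, select the
  recessive solution and fix its sign.\<close>

locale turning_point =
  fixes \<nu> :: real and v v' :: "real \<Rightarrow> real"
  assumes nu_pos: "0 < \<nu>"
    and v_deriv: "\<And>s. (v has_real_derivative v' s) (at s)"
    and v'_deriv: "\<And>s. (v' has_real_derivative \<nu>\<^sup>2 * (1 - exp (2 * s)) * v s) (at s)"
    and v_at_bot: "(v \<longlongrightarrow> 0) at_bot"
    and v'_at_bot: "(v' \<longlongrightarrow> 0) at_bot"
    and v_pos_at_bot: "eventually (\<lambda>s. 0 < v s) at_bot"
begin

section \<open>Growth up to the turning point\<close>

lemma v_cont: "continuous_on S v"
  by (meson v_deriv DERIV_isCont continuous_at_imp_continuous_on)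

text \<open>Left of the turning point \<open>v''\<close> is a nonnegative multiple of
  \<open>v\<close>, so the derivative of \<open>v v'\<close> is a sum of two nonnegative
  terms.\<close>

lemma vv'_nonneg:
  assumes "s \<le> 0" shows "0 \<le> v s * v' s"
proof (rule nonneg_of_deriv_nonneg_at_bot[where f = "\<lambda>t. v t * v' t" and b = s])
  show "((\<lambda>t. v t * v' t) has_real_derivative (v' t)\<^sup>2 + \<nu>\<^sup>2 * (1 - exp (2 * t)) * (v t)\<^sup>2) (at t)" for t
    by (auto intro!: derivative_eq_intros v_deriv v'_deriv simp: power2_eq_square algebra_simps)
  show "0 \<le> (v' t)\<^sup>2 + \<nu>\<^sup>2 * (1 - exp (2 * t)) * (v t)\<^sup>2" if "t \<le> s" for t
    using that assms by simp
  show "((\<lambda>t. v t * v' t) \<longlongrightarrow> 0) at_bot"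
    using tendsto_mult[OF v_at_bot v'_at_bot] by simp
qed

text \<open>By \<open>vv'_nonneg\<close> the square of \<open>v\<close> is nondecreasing, so
  \<open>v\<close>, once positive near \<open>-\<infinity>\<close>, cannot come back to
  zero.\<close>

lemma v_pos:
  assumes "s \<le> 0" shows "0 < v s"
proof -
  obtain t0 where t0: "\<And>t. t \<le> t0 \<Longrightarrow> 0 < v t"
    using v_pos_at_bot by (auto simp: eventually_at_bot_linorder)
  define t where "t = min s t0"
  have t: "0 < v t" "t \<le> s" using t0 by (auto simp: t_def)
  have sq: "(v t)\<^sup>2 \<le> (v x)\<^sup>2" if "t \<le> x" "x \<le> s" for x
  proof (rule DERIV_nonneg_imp_nondecreasing[OF that(1)])
    fix y assume "t \<le> y" "y \<le> x"
    moreover have "((\<lambda>t. (v t)\<^sup>2) has_real_derivative 2 * (v y * v' y)) (at y)"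
      by (auto intro!: derivative_eq_intros v_deriv)
    ultimately show "\<exists>D. ((\<lambda>t. (v t)\<^sup>2) has_real_derivative D) (at y) \<and> 0 \<le> D"
      using vv'_nonneg[of y] that assms
      by (intro exI[of _ "2 * (v y * v' y)"] conjI) auto
  qed
  have nz: "v x \<noteq> 0" if "t \<le> x" "x \<le> s" for x
    using sq[OF that] t(1) by auto
  show ?thesis
  proof (rule ccontr)
    assume "\<not> 0 < v s"
    then have "\<exists>x\<ge>t. x \<le> s \<and> v x = 0"
      by (intro IVT2') (use t v_cont in auto)
    then show False using nz by blast
  qed
qed

lemma v'_nonneg: "s \<le> 0 \<Longrightarrow> 0 \<le> v' s"
  using vv'_nonneg[of s] v_pos[of s] by (simp add: zero_le_mult_iff)

lemma v_mono:
  assumes "a \<le> b" "b \<le> 0" shows "v a \<le> v b"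
  by (rule DERIV_nonneg_imp_nondecreasing[OF assms(1)])
    (use assms v_deriv v'_nonneg in \<open>meson order.trans\<close>)

lemma v'_mono:
  assumes "a \<le> b" "b \<le> 0" shows "v' a \<le> v' b"
proof (rule DERIV_nonneg_imp_nondecreasing[OF assms(1)])
  fix x assume "a \<le> x" "x \<le> b"
  then have "0 \<le> \<nu>\<^sup>2 * (1 - exp (2 * x)) * v x"
    using v_pos[of x] assms by simp
  then show "\<exists>y. (v' has_real_derivative y) (at x) \<and> 0 \<le> y"
    using v'_deriv by blast
qed

text \<open>The energy \<open>v'\<^sup>2 - \<nu>\<^sup>2 (1 - exp (2 * s)) v\<^sup>2\<close> starts
  from 0 at \<open>-\<infinity>\<close>. By the equation only the derivative of the coefficient
  survives, and it has the right sign.\<close>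

lemma v'_ge:
  assumes "s \<le> 0" shows "\<nu> * sqrt (1 - exp (2 * s)) * v s \<le> v' s"
proof -
  have "0 \<le> (v' s)\<^sup>2 - \<nu>\<^sup>2 * (1 - exp (2 * s)) * (v s)\<^sup>2"
  proof (rule nonneg_of_deriv_nonneg_at_bot
      [where f = "\<lambda>t. (v' t)\<^sup>2 - \<nu>\<^sup>2 * (1 - exp (2 * t)) * (v t)\<^sup>2" and b = s])
    show "((\<lambda>t. (v' t)\<^sup>2 - \<nu>\<^sup>2 * (1 - exp (2 * t)) * (v t)\<^sup>2)
        has_real_derivative 2 * \<nu>\<^sup>2 * exp (2 * t) * (v t)\<^sup>2) (at t)" for t
      by (auto intro!: derivative_eq_intros v_deriv v'_deriv simp: power2_eq_square algebra_simps)
    have "((\<lambda>t::real. exp (2 * t)) \<longlongrightarrow> 0) at_bot"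
      by (intro filterlim_compose[OF exp_at_bot] filterlim_tendsto_pos_mult_at_bot[where c=2])
        (auto simp: filterlim_ident)
    then have "((\<lambda>t. (v' t)\<^sup>2 - \<nu>\<^sup>2 * (1 - exp (2 * t)) * (v t)\<^sup>2)
        \<longlongrightarrow> 0\<^sup>2 - \<nu>\<^sup>2 * (1 - 0) * 0\<^sup>2) at_bot"
      by (intro tendsto_intros v_at_bot v'_at_bot)
    then show "((\<lambda>t. (v' t)\<^sup>2 - \<nu>\<^sup>2 * (1 - exp (2 * t)) * (v t)\<^sup>2) \<longlongrightarrow> 0) at_bot"
      by simp
  qed auto
  then have "(\<nu> * sqrt (1 - exp (2 * s)) * v s)\<^sup>2 \<le> (v' s)\<^sup>2"
    using assms by (simp add: power_mult_distrib)
  then show ?thesis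
    by (rule power2_le_imp_le) (rule v'_nonneg[OF assms])
qed

text \<open>As \<open>v'\<close> increases, \<open>v\<close> rises by at least
  \<open>\<delta> * v' (- \<delta>)\<close> on the way to 0. With \<open>v'_ge\<close> this makes
  \<open>v (- \<delta>)\<close> smaller than \<open>v 0\<close> by a factor of order
  \<open>\<nu>\<close>.\<close>

lemma v_decay:
  assumes "0 \<le> \<delta>"
  shows "v (- \<delta>) * (1 + \<delta> * \<nu> * sqrt (1 - exp (- 2 * \<delta>))) \<le> v 0"
proof -
  have "v (-\<delta>) + \<delta> * v' (-\<delta>) \<le> v 0"
  proof (cases "\<delta> = 0")
    case False
    then have "\<exists>z>-\<delta>. z < 0 \<and> v 0 - v (-\<delta>) = (0 - -\<delta>) * v' z"
      using assms by (intro MVT2 v_deriv) auto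
    then obtain z where z: "-\<delta> < z" "z < 0" "v 0 - v (-\<delta>) = \<delta> * v' z" by auto
    have "\<delta> * v' (-\<delta>) \<le> \<delta> * v' z"
      using z assms by (intro mult_left_mono v'_mono) auto
    then show ?thesis using z by linarith
  qed auto
  moreover have "\<delta> * (\<nu> * sqrt (1 - exp (- 2 * \<delta>)) * v (-\<delta>)) \<le> \<delta> * v' (-\<delta>)"
    using v'_ge[of "-\<delta>"] assms by (intro mult_left_mono) auto
  ultimately show ?thesis by (simp add: algebra_simps)
qed

text \<open>The radial factor \<open>r powr (1 - d / 2)\<close> may blow up at the origin; in
  \<open>s\<close> it is a multiple of \<open>exp (- b * s)\<close> with
  \<open>b = d / 2 - 1\<close>. Where the logarithmic derivative of \<open>v\<close> is at least
  \<open>b\<close>, the product still increases.\<close>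

lemma weighted_v_mono:
  assumes "0 \<le> \<delta>" "b \<le> \<nu> * sqrt (1 - exp (- 2 * \<delta>))" "s \<le> - \<delta>"
  shows "exp (- b * s) * v s \<le> exp (b * \<delta>) * v (- \<delta>)"
proof -
  have "exp (- b * s) * v s \<le> exp (- b * (-\<delta>)) * v (- \<delta>)"
  proof (rule DERIV_nonneg_imp_nondecreasing[OF assms(3)])
    fix t assume t: "s \<le> t" "t \<le> -\<delta>"
    have "((\<lambda>t. exp (- b * t) * v t) has_real_derivative exp (- b * t) * (v' t - b * v t)) (at t)"
      by (auto intro!: derivative_eq_intros v_deriv simp: algebra_simps)
    moreover have "b * v t \<le> v' t"
    proof -
      have "b \<le> \<nu> * sqrt (1 - exp (2 * t))"
        using assms(2) by (rule order.trans) (use t nu_pos in auto)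
      then have "b * v t \<le> \<nu> * sqrt (1 - exp (2 * t)) * v t"
        using v_pos[of t] t assms(1) by (intro mult_right_mono) auto
      then show ?thesis using v'_ge[of t] t assms(1) by simp
    qed
    ultimately show "\<exists>D. ((\<lambda>t. exp (- b * t) * v t) has_real_derivative D) (at t) \<and> 0 \<le> D"
      by (intro exI conjI) auto
  qed
  then show ?thesis by simp
qed

text \<open>For any weight \<open>f\<close>, the quadratic form
  \<open>f v'\<^sup>2 - f' v v' + (f'' / 2 + \<nu>\<^sup>2 q f) v\<^sup>2\<close> has derivative
  \<open>(f''' / 2 + 2 \<nu>\<^sup>2 q f' + \<nu>\<^sup>2 q' f) v\<^sup>2\<close>, where \<open>q s = exp (2 * s) - 1\<close>. The choice
  \<open>f = 1 / sqrt q\<close> cancels the terms in \<open>\<nu>\<^sup>2\<close>, and \<open>f\<close> is completely monotone, so that the form is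
  decreasing and bounds \<open>\<nu>\<^sup>2 sqrt q v\<^sup>2\<close> from above.\<close>

definition amp :: "real \<Rightarrow> real" where
  "amp s = (let g = sqrt (exp (2 * s) - 1); i = 1 / g in
     i * (v' s)\<^sup>2 + (i + i ^ 3) * (v s * v' s)
     + ((i + 4 * i ^ 3 + 3 * i ^ 5) / 2 + \<nu>\<^sup>2 * g) * (v s)\<^sup>2)"

lemma amp_deriv:
  assumes "0 < s"
  defines "i \<equiv> 1 / sqrt (exp (2 * s) - 1)"
  shows "(amp has_real_derivative
    - ((i + i ^ 3) * (1 + 12 * i\<^sup>2 + 15 * i ^ 4) / 2 * (v s)\<^sup>2)) (at s)"
proof -
  define g where "g = sqrt (exp (2 * s) - 1)"
  define G where "G = (\<lambda>s::real. sqrt (exp (2 * s) - 1))"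
  define I where "I = (\<lambda>s. 1 / G s)"
  have g0: "0 < g" using assms by (simp add: g_def)
  have g2: "exp (2 * s) = g\<^sup>2 + 1" using assms by (simp add: g_def)
  have i: "i = 1 / g" by (simp add: i_def g_def)
  have gi: "g * i = 1" using g0 by (simp add: i)
  have Gs: "G s = g" by (simp add: G_def g_def)
  have Is: "I s = i" by (simp add: I_def Gs i)
  \<comment> \<open>Since \<open>exp (2 * s) = g\<^sup>2 + 1\<close>, differentiation stays
    polynomial in \<open>g\<close> and \<open>i\<close>: \<open>g' = g + i\<close> and
    \<open>i' = - (i + i ^ 3)\<close>.\<close>
  have "(G has_real_derivative exp (2 * s) / sqrt (exp (2 * s) - 1)) (at s)"
    unfolding G_def using assms(1) by (auto intro!: derivative_eq_intros simp: field_simps)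
  also have "exp (2 * s) / sqrt (exp (2 * s) - 1) = g + i"
    unfolding g_def[symmetric] g2 using g0 by (simp add: i field_simps power2_eq_square)
  finally have Gd: "(G has_real_derivative (g + i)) (at s)" .
  have "(I has_real_derivative - (g + i) / g\<^sup>2) (at s)"
    unfolding I_def using g0 Gs Gd
    by (auto intro!: derivative_eq_intros simp: power2_eq_square)
  also have "- (g + i) / g\<^sup>2 = - (i + i ^ 3)"
    using g0 by (simp add: i field_simps eval_nat_numeral)
  finally have Id: "(I has_real_derivative - (i + i ^ 3)) (at s)" .
  have amp: "amp = (\<lambda>s. I s * (v' s)\<^sup>2 + (I s + I s ^ 3) * (v s * v' s)
     + ((I s + 4 * I s ^ 3 + 3 * I s ^ 5) / 2 + \<nu>\<^sup>2 * G s) * (v s)\<^sup>2)"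
    by (rule ext) (simp add: amp_def G_def I_def Let_def)
  define V where "V = v s"
  define W where "W = v' s"
  define A where "A = \<nu>\<^sup>2 * (1 - exp (2 * s)) * v s"
  have A: "A = - \<nu>\<^sup>2 * g\<^sup>2 * V" by (simp add: A_def g2 V_def)
  have d1: "((\<lambda>s. I s * (v' s)\<^sup>2) has_real_derivative - (i + i ^ 3) * W\<^sup>2 + i * (2 * W * A)) (at s)"
    by (auto intro!: derivative_eq_intros Id v'_deriv simp: Is W_def A_def)
  have d2: "((\<lambda>s. (I s + I s ^ 3) * (v s * v' s)) has_real_derivative
      - ((i + i ^ 3) * (1 + 3 * i\<^sup>2)) * (V * W) + (i + i ^ 3) * (W * W + V * A)) (at s)"
    by (auto intro!: derivative_eq_intros Id v_deriv v'_deriv simp: Is V_def W_def A_def algebra_simps)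
  have d3: "((\<lambda>s. ((I s + 4 * I s ^ 3 + 3 * I s ^ 5) / 2 + \<nu>\<^sup>2 * G s) * (v s)\<^sup>2) has_real_derivative
      (- ((i + i ^ 3) * (1 + 12 * i\<^sup>2 + 15 * i ^ 4) / 2) + \<nu>\<^sup>2 * (g + i)) * V\<^sup>2
      + ((i + 4 * i ^ 3 + 3 * i ^ 5) / 2 + \<nu>\<^sup>2 * g) * (2 * V * W)) (at s)"
  proof -
    have "((\<lambda>s. (I s + 4 * I s ^ 3 + 3 * I s ^ 5) / 2 + \<nu>\<^sup>2 * G s) has_real_derivative
      - ((i + i ^ 3) * (1 + 12 * i\<^sup>2 + 15 * i ^ 4) / 2) + \<nu>\<^sup>2 * (g + i)) (at s)"
      by (auto intro!: derivative_eq_intros Id Gd simp: Is field_simps eval_nat_numeral)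
    moreover have "((\<lambda>s. (v s)\<^sup>2) has_real_derivative 2 * V * W) (at s)"
      by (auto intro!: derivative_eq_intros v_deriv simp: V_def W_def)
    ultimately show ?thesis
      by (rule DERIV_mult'[THEN DERIV_cong]) (simp add: Is Gs V_def)
  qed
  \<comment> \<open>The terms in \<open>W\<^sup>2\<close> and in \<open>V * W\<close> cancel
    completely. Among those in \<open>V\<^sup>2\<close> the \<open>\<nu>\<^sup>2\<close> part
    cancels by \<open>g * i = 1\<close>, which leaves half the third derivative of
    \<open>i\<close>.\<close>
  have "- (i + i ^ 3) * W\<^sup>2 + i * (2 * W * A)
     + (- ((i + i ^ 3) * (1 + 3 * i\<^sup>2)) * (V * W) + (i + i ^ 3) * (W * W + V * A))
     + ((- ((i + i ^ 3) * (1 + 12 * i\<^sup>2 + 15 * i ^ 4) / 2) + \<nu>\<^sup>2 * (g + i)) * V\<^sup>2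
      + ((i + 4 * i ^ 3 + 3 * i ^ 5) / 2 + \<nu>\<^sup>2 * g) * (2 * V * W))
     = - ((i + i ^ 3) * (1 + 12 * i\<^sup>2 + 15 * i ^ 4) / 2 * V\<^sup>2)"
  proof -
    have "i * (2 * W * A) = - 2 * \<nu>\<^sup>2 * g * (V * W)"
      and "(i + i ^ 3) * (V * A) = - \<nu>\<^sup>2 * (g + i) * V\<^sup>2"
      using gi unfolding A by algebra+
    moreover have "(i + i ^ 3) * (1 + 3 * i\<^sup>2) = i + 4 * i ^ 3 + 3 * i ^ 5"
      by algebra
    ultimately show ?thesis
      by (simp only: distrib_left[of "i + i ^ 3"]) (simp add: algebra_simps power2_eq_square)
  qed
  with DERIV_add[OF DERIV_add[OF d1 d2] d3] show ?thesis
    unfolding amp V_def[symmetric] by simp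
qed

text \<open>Apart from the term in \<open>\<nu>\<^sup>2\<close>, \<open>amp\<close> is
  \<open>1 / g\<close> times a quadratic form in \<open>v'\<close> and \<open>v\<close>, which is
  nonnegative by completing the square.\<close>

lemma amp_ge:
  assumes "0 < s"
  shows "\<nu>\<^sup>2 * sqrt (exp (2 * s) - 1) * (v s)\<^sup>2 \<le> amp s"
proof -
  define g where "g = sqrt (exp (2 * s) - 1)"
  have g0: "0 < g" using assms by (simp add: g_def)
  define a where "a = 1 / g\<^sup>2"
  have a0: "0 \<le> a" by (simp add: a_def)
  have "amp s - \<nu>\<^sup>2 * g * (v s)\<^sup>2 =
      (1 / g) * ((v' s)\<^sup>2 + (1 + a) * (v s * v' s) + (1 + 4 * a + 3 * a\<^sup>2) / 2 * (v s)\<^sup>2)"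
    unfolding amp_def Let_def g_def[symmetric] a_def using g0
    by (simp add: field_simps power2_eq_square eval_nat_numeral)
  also have "(v' s)\<^sup>2 + (1 + a) * (v s * v' s) + (1 + 4 * a + 3 * a\<^sup>2) / 2 * (v s)\<^sup>2
     = (v' s + (1 + a) / 2 * v s)\<^sup>2 + (1 + 6 * a + 5 * a\<^sup>2) / 4 * (v s)\<^sup>2"
    by (simp add: power2_eq_square field_simps)
  also have "1 / g * \<dots> \<ge> 0" using g0 a0 by (intro mult_nonneg_nonneg add_nonneg_nonneg) auto
  finally show ?thesis by (simp add: g_def)
qed

section \<open>The Airy scale around the turning point\<close>

context
  fixes h :: real
  assumes h: "0 < h" "\<nu>\<^sup>2 * h ^ 3 = 1"
begin

lemma nu_h: "\<nu>\<^sup>2 = 1 / h ^ 3"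
  using h by (simp add: field_simps)

text \<open>\<open>h\<close> is the Airy length. Somewhere in \<open>[-h, 0]\<close> the slope is at
  most \<open>v 0 / h\<close>. From there on \<open>v''\<close>, at most
  \<open>\<nu>\<^sup>2 * 2 * h * v 0\<close>, adds no more than \<open>2 * v 0 / h\<close>.\<close>

lemma v'_0_le: "h * v' 0 \<le> 3 * v 0"
proof -
  have "\<exists>z>-h. z < 0 \<and> v 0 - v (-h) = (0 - -h) * v' z"
    using h by (intro MVT2 v_deriv) auto
  then obtain z where z: "-h < z" "z < 0" "v 0 - v (-h) = h * v' z" by auto
  have "\<exists>y>z. y < 0 \<and> v' 0 - v' z = (0 - z) * (\<nu>\<^sup>2 * (1 - exp (2 * y)) * v y)"
    using z by (intro MVT2 v'_deriv) auto
  then obtain y where y: "z < y" "y < 0" "v' 0 - v' z = -z * (\<nu>\<^sup>2 * (1 - exp (2 * y)) * v y)"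
    by auto
  have q: "1 - exp (2 * y) \<le> 2 * h"
    using exp_ge_add_one_self[of "2 * y"] z y by linarith
  have "(1 - exp (2 * y)) * v y \<le> 2 * h * v 0"
    using q y v_pos[of y] v_mono[of y 0] h by (intro mult_mono) auto
  moreover have "-z * \<nu>\<^sup>2 \<le> h * \<nu>\<^sup>2"
    using z by (intro mult_right_mono) auto
  ultimately have "(-z * \<nu>\<^sup>2) * ((1 - exp (2 * y)) * v y) \<le> (h * \<nu>\<^sup>2) * (2 * h * v 0)"
    using z y h v_pos[of y] by - (rule mult_mono, auto)
  then have "h * (v' 0 - v' z) \<le> h * (h * \<nu>\<^sup>2 * (2 * h * v 0))"
    using y h by (intro mult_left_mono) (auto simp: algebra_simps)
  also have "\<dots> = 2 * v 0 * (\<nu>\<^sup>2 * h ^ 3)" by (simp add: power3_eq_cube)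
  finally have "h * (v' 0 - v' z) \<le> 2 * v 0" using h by simp
  moreover have "h * v' z \<le> v 0" using z v_pos[of "-h"] h by simp
  ultimately show ?thesis by (simp add: algebra_simps)
qed

text \<open>The slope on this interval is at most \<open>v' 0 \<le> 3 * v 0 / h\<close>, so a step
  of \<open>h / 6\<close> loses at most half of \<open>v 0\<close>.\<close>

lemma v_lower:
  assumes "- h / 6 \<le> s" "s \<le> 0" shows "v 0 / 2 \<le> v s"
proof (cases "s = 0")
  case False
  then have "\<exists>z>s. z < 0 \<and> v 0 - v s = (0 - s) * v' z"
    using assms by (intro MVT2 v_deriv) auto
  then obtain z where z: "s < z" "z < 0" "v 0 - v s = - s * v' z" by auto
  have "- s * v' z \<le> h / 6 * v' 0"
    using assms z v'_nonneg[of z] h by (intro mult_mono v'_mono) auto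
  then show ?thesis using v'_0_le z by simp
qed (use v_pos[of 0] in simp)

text \<open>A bootstrap on \<open>[0, h / 2]\<close>: the maximum \<open>M\<close> of the absolute
  value of \<open>v\<close> bounds \<open>v''\<close>, hence \<open>v'\<close>, hence
  \<open>M\<close> itself. On this length \<open>M\<close> returns with the factor 1/2 and can be
  absorbed.\<close>

lemma v_bounds_at_turning_point:
  assumes "h \<le> 1"
  shows "\<bar>v (h / 2)\<bar> \<le> 5 * v 0" and "\<bar>v' (h / 2)\<bar> \<le> 8 * v 0 / h"
proof -
  obtain x where x: "x \<in> {0..h/2}" "\<And>y. y \<in> {0..h/2} \<Longrightarrow> \<bar>v y\<bar> \<le> \<bar>v x\<bar>"
    using continuous_attains_sup[of "{0..h/2}" "\<lambda>s. \<bar>v s\<bar>"] 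
      continuous_on_rabs[OF v_cont] h by fastforce
  define M where "M = \<bar>v x\<bar>"
  have q: "\<bar>1 - exp (2 * s)\<bar> \<le> 2 * h" if "0 \<le> s" "s \<le> h / 2" for s
  proof -
    have "exp (2 * s) \<le> exp h" using that by simp
    also have "\<dots> \<le> 1 + h + h\<^sup>2" using h assms by (intro exp_bound) auto
    also have "h\<^sup>2 \<le> h" using h assms by (simp add: power2_eq_square mult_left_le)
    finally show ?thesis using that by auto
  qed
  have v'b: "\<bar>v' s\<bar> \<le> (3 * v 0 + M) / h" if s: "0 \<le> s" "s \<le> h / 2" for s
  proof -
    have "\<bar>v' s - v' 0\<bar> \<le> h / 2 * (\<nu>\<^sup>2 * (2 * h) * M)"
    proof (cases "s = 0")
      case False
      then have "\<exists>y>0. y < s \<and> v' s - v' 0 = (s - 0) * (\<nu>\<^sup>2 * (1 - exp (2 * y)) * v y)"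
        using s by (intro MVT2 v'_deriv) auto
      then obtain y where y: "0 < y" "y < s" "v' s - v' 0 = s * (\<nu>\<^sup>2 * (1 - exp (2 * y)) * v y)"
        by auto
      have "s * (\<nu>\<^sup>2 * \<bar>1 - exp (2 * y)\<bar> * \<bar>v y\<bar>) \<le> h / 2 * (\<nu>\<^sup>2 * (2 * h) * M)"
        unfolding M_def using y s h q[of y] x(2)[of y] by (intro mult_mono mult_nonneg_nonneg) auto
      then show ?thesis using y s by (simp add: abs_mult)
    qed (use h in \<open>simp add: M_def\<close>)
    also have "\<dots> = M / h" using h by (simp add: nu_h field_simps power3_eq_cube)
    finally have "\<bar>v' s\<bar> \<le> \<bar>v' 0\<bar> + M / h" by linarith
    moreover have "\<bar>v' 0\<bar> \<le> 3 * v 0 / h"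
      using v'_0_le v'_nonneg[of 0] h by (simp add: field_simps)
    ultimately show ?thesis by (simp add: add_divide_distrib)
  qed
  have "\<bar>v x - v 0\<bar> \<le> h / 2 * ((3 * v 0 + M) / h)"
  proof (cases "x = 0")
    case False
    then have "\<exists>y>0. y < x \<and> v x - v 0 = (x - 0) * v' y"
      using x by (intro MVT2 v_deriv) auto
    then obtain y where y: "0 < y" "y < x" "v x - v 0 = x * v' y" by auto
    have "x * \<bar>v' y\<bar> \<le> h / 2 * ((3 * v 0 + M) / h)"
      using y x v'b[of y] h by (intro mult_mono) auto
    then show ?thesis using y by (simp add: abs_mult)
  qed (use h v_pos[of 0] in \<open>simp add: M_def\<close>)
  then have "\<bar>v x - v 0\<bar> \<le> (3 * v 0 + M) / 2" using h by simp
  then have "M \<le> v 0 + (3 * v 0 + M) / 2"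
    unfolding M_def using v_pos[of 0] by linarith
  then have M: "M \<le> 5 * v 0" by (simp add: field_simps)
  then show "\<bar>v (h / 2)\<bar> \<le> 5 * v 0" using x(2)[of "h/2"] h by (simp add: M_def)
  have "\<bar>v' (h/2)\<bar> \<le> (3 * v 0 + M) / h" using v'b[of "h/2"] h by simp
  also have "\<dots> \<le> 8 * v 0 / h" using M h by (intro divide_right_mono) auto
  finally show "\<bar>v' (h / 2)\<bar> \<le> 8 * v 0 / h" .
qed

text \<open>At \<open>h / 2\<close> one has \<open>h \<le> g\<^sup>2 \<le> 2 * h\<close>, so each of
  the three parts of \<open>g * amp\<close> is a multiple of
  \<open>(v 0)\<^sup>2 / h\<^sup>2\<close>. Their constants are 64, 80 and 150, with sum
  294.\<close>

lemma amp_turning_point_le: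
  assumes "h \<le> 1"
  shows "amp (h / 2) \<le> 294 * \<nu>\<^sup>2 * sqrt h * (v 0)\<^sup>2"
proof -
  define g where "g = sqrt (exp h - 1)"
  have eh: "exp h \<le> 1 + h + h\<^sup>2" using h assms by (intro exp_bound) auto
  have "h\<^sup>2 \<le> h" using h assms by (simp add: power2_eq_square mult_left_le)
  then have eh2: "exp h - 1 \<le> 2 * h" using eh by simp
  have eh1: "h \<le> exp h - 1" using exp_ge_add_one_self[of h] by linarith
  have g0: "0 < g" using h by (simp add: g_def)
  have g2: "g\<^sup>2 = exp h - 1" using h by (simp add: g_def)
  define a where "a = 1 / g\<^sup>2"
  have a0: "0 \<le> a" by (simp add: a_def)
  have a1: "a \<le> 1 / h" unfolding a_def g2 using h eh1 by (intro divide_left_mono) auto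
  have h1: "1 \<le> 1 / h" using h assms by simp
  let ?v = "v (h/2)" and ?w = "v' (h/2)"
  note b = v_bounds_at_turning_point[OF assms]
  have v0: "0 < v 0" by (simp add: v_pos)
  have 1: "?w\<^sup>2 \<le> 64 * (v 0)\<^sup>2 / h\<^sup>2"
    using power_mono[OF b(2), of 2] by (simp add: power_divide power_mult_distrib)
  have "1 + a \<le> 2 / h" using a1 h1 by linarith
  then have "(1 + a) * (\<bar>?v\<bar> * \<bar>?w\<bar>) \<le> (2 / h) * ((5 * v 0) * (8 * v 0 / h))"
    using a0 b v0 h by (intro mult_mono) auto
  moreover have "(1 + a) * (?v * ?w) \<le> (1 + a) * (\<bar>?v\<bar> * \<bar>?w\<bar>)"
    using a0 by (intro mult_left_mono) (auto simp flip: abs_mult)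
  ultimately have 2: "(1 + a) * (?v * ?w) \<le> 80 * (v 0)\<^sup>2 / h\<^sup>2"
    by (simp add: power2_eq_square)
  have "1 + 4 * a + 3 * a\<^sup>2 \<le> 1 / h\<^sup>2 + 4 * (1 / h\<^sup>2) + 3 * (1 / h\<^sup>2)"
  proof -
    have "a\<^sup>2 \<le> 1 / h\<^sup>2" using power_mono[OF a1 a0, of 2] by (simp add: power_divide)
    moreover have "1 / h \<le> 1 / h\<^sup>2" using h \<open>h\<^sup>2 \<le> h\<close> by (intro divide_left_mono) auto
    ultimately show ?thesis using a1 h1 by linarith
  qed
  moreover have "\<nu>\<^sup>2 * g\<^sup>2 \<le> 2 / h\<^sup>2"
  proof -
    have "\<nu>\<^sup>2 * g\<^sup>2 \<le> \<nu>\<^sup>2 * (2 * h)" unfolding g2 using eh2 by (intro mult_left_mono) auto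
    also have "\<dots> = 2 / h\<^sup>2" using h by (simp add: nu_h field_simps eval_nat_numeral)
    finally show ?thesis .
  qed
  ultimately have "(1 + 4 * a + 3 * a\<^sup>2) / 2 + \<nu>\<^sup>2 * g\<^sup>2 \<le> 6 / h\<^sup>2" by (simp add: field_simps)
  moreover have "?v\<^sup>2 \<le> 25 * (v 0)\<^sup>2"
    using power_mono[OF b(1), of 2] by (simp add: power_mult_distrib)
  ultimately have 3: "((1 + 4 * a + 3 * a\<^sup>2) / 2 + \<nu>\<^sup>2 * g\<^sup>2) * ?v\<^sup>2 \<le> 6 / h\<^sup>2 * (25 * (v 0)\<^sup>2)"
    by (intro mult_mono) auto
  have "amp (h / 2) = 1 / g * (?w\<^sup>2 + (1 + a) * (?v * ?w) + ((1 + 4 * a + 3 * a\<^sup>2) / 2 + \<nu>\<^sup>2 * g\<^sup>2) * ?v\<^sup>2)"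
    unfolding amp_def Let_def a_def using g0
    by (simp add: g_def[symmetric] field_simps eval_nat_numeral)
  also have "\<dots> \<le> 1 / g * (294 * (v 0)\<^sup>2 / h\<^sup>2)"
  proof (intro mult_left_mono)
    show "?w\<^sup>2 + (1 + a) * (?v * ?w) + ((1 + 4 * a + 3 * a\<^sup>2) / 2 + \<nu>\<^sup>2 * g\<^sup>2) * ?v\<^sup>2
        \<le> 294 * (v 0)\<^sup>2 / h\<^sup>2"
      using add_mono[OF add_mono[OF 1 2] 3] by (simp add: add_divide_distrib[symmetric])
  qed (use g0 in auto)
  also have "\<dots> \<le> 1 / sqrt h * (294 * (v 0)\<^sup>2 / h\<^sup>2)"
    using h eh1 by (intro mult_right_mono divide_left_mono) (auto simp: g_def)
  also have "\<dots> = 294 * \<nu>\<^sup>2 * sqrt h * (v 0)\<^sup>2"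
  proof -
    have "1 / sqrt h = sqrt h / h" using h by (simp add: real_div_sqrt field_simps)
    then show ?thesis unfolding nu_h by (simp add: eval_nat_numeral)
  qed
  finally show ?thesis .
qed

text \<open>\<open>amp\<close> decreases, so its value at \<open>h / 2\<close> controls all later
  ones. The start lies off the turning point because the weight \<open>1 / sqrt q\<close> is
  singular there.\<close>

lemma v_upper:
  assumes "h \<le> 1" "h / 2 \<le> s"
  shows "sqrt (exp (2 * s) - 1) * (v s)\<^sup>2 \<le> 294 * sqrt h * (v 0)\<^sup>2"
proof -
  have "amp s \<le> amp (h / 2)"
  proof (rule DERIV_nonpos_imp_nonincreasing[OF assms(2)])
    fix t assume "h / 2 \<le> t" "t \<le> s"
    then have t: "0 < t" using h by simp
    show "\<exists>y. (amp has_real_derivative y) (at t) \<and> y \<le> 0"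
      by (rule exI, rule conjI, rule amp_deriv[OF t])
        (use t in \<open>auto simp: mult_nonneg_nonneg intro!: mult_nonpos_nonneg divide_nonpos_nonneg\<close>)
  qed
  then have "\<nu>\<^sup>2 * (sqrt (exp (2 * s) - 1) * (v s)\<^sup>2) \<le> \<nu>\<^sup>2 * (294 * sqrt h * (v 0)\<^sup>2)"
    using amp_ge[of s] amp_turning_point_le[OF assms(1)] assms h by (simp add: algebra_simps)
  then show ?thesis using nu_pos by simp
qed

end

end

subsection \<open>Bessel functions in the logarithmic variable\<close>

text \<open>Coefficients in the variable \<open>z = (x / 2)\<^sup>2\<close>, after the factor
  \<open>(x / 2) powr \<nu>\<close> is split off. What remains is an entire power series.\<close>

definition bessel_coeff :: "real \<Rightarrow> nat \<Rightarrow> real" where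
  "bessel_coeff \<nu> n = (-1) ^ n / (fact n * Gamma (real n + \<nu> + 1))"

definition bessel_series :: "real \<Rightarrow> real \<Rightarrow> real" where
  "bessel_series \<nu> z = (\<Sum>n. bessel_coeff \<nu> n * z ^ n)"

definition bessel_series' :: "real \<Rightarrow> real \<Rightarrow> real" where
  "bessel_series' \<nu> z = (\<Sum>n. diffs (bessel_coeff \<nu>) n * z ^ n)"

definition bessel_series'' :: "real \<Rightarrow> real \<Rightarrow> real" where
  "bessel_series'' \<nu> z = (\<Sum>n. diffs (diffs (bessel_coeff \<nu>)) n * z ^ n)"

context
  fixes \<nu> :: real
  assumes nu: "0 < \<nu>"
begin

lemma bessel_coeff_Suc:
  "(real n + \<nu> + 1) * (real (Suc n) * bessel_coeff \<nu> (Suc n)) = - bessel_coeff \<nu> n"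
proof -
  have "Gamma (real (Suc n) + \<nu> + 1) = (real n + \<nu> + 1) * Gamma (real n + \<nu> + 1)"
    using Gamma_plus1[of "real n + \<nu> + 1"] nonpos_Ints_nonpos[of "real n + \<nu> + 1"] nu
    by (force simp: algebra_simps)
  moreover have "Gamma (real n + \<nu> + 1) > 0" using nu by (intro Gamma_real_pos) auto
  moreover have "(real n + \<nu> + 1) > 0" using nu by auto
  ultimately show ?thesis
    unfolding bessel_coeff_def by (simp add: divide_simps del: of_nat_Suc)
qed

lemma bessel_coeff_summable: "summable (\<lambda>n. bessel_coeff \<nu> n * z ^ n)"
\<comment> \<open>The ratio of consecutive terms is
  \<open>\<bar>z\<bar> / ((n + \<nu> + 1) * (n + 1))\<close>, at most 1/2 once \<open>n\<close>
  reaches \<open>2 * \<bar>z\<bar>\<close>.\<close>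
proof (rule summable_ratio_test[where c = "1/2" and N = "nat \<lceil>2 * \<bar>z\<bar>\<rceil>"])
  fix n assume "nat \<lceil>2 * \<bar>z\<bar>\<rceil> \<le> n"
  then have n: "2 * \<bar>z\<bar> \<le> real n" by linarith
  let ?d = "(real n + \<nu> + 1) * real (Suc n)"
  have d: "0 < ?d" using nu by simp
  have "bessel_coeff \<nu> (Suc n) = - bessel_coeff \<nu> n / ?d"
    using bessel_coeff_Suc[of n] d by (simp add: field_simps del: of_nat_Suc)
  then have "norm (bessel_coeff \<nu> (Suc n) * z ^ Suc n) = \<bar>z\<bar> / ?d * norm (bessel_coeff \<nu> n * z ^ n)"
    using nu by (simp add: abs_mult power_abs del: of_nat_Suc)
  also have "\<bar>z\<bar> / ?d \<le> 1 / 2"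
  proof -
    have "1 * real n \<le> (real n + \<nu> + 1) * real (Suc n)"
      using nu by (intro mult_mono) auto
    then have "2 * \<bar>z\<bar> \<le> ?d" using n by linarith
    then show ?thesis using d by (simp add: field_simps del: of_nat_Suc)
  qed
  finally show "norm (bessel_coeff \<nu> (Suc n) * z ^ Suc n) \<le> 1 / 2 * norm (bessel_coeff \<nu> n * z ^ n)"
    by (simp add: mult_right_mono)
qed simp

lemma diffs_bessel_coeff_summable: "summable (\<lambda>n. diffs (bessel_coeff \<nu>) n * z ^ n)"
  by (rule termdiff_converges_all) (rule bessel_coeff_summable)

lemma diffs_diffs_bessel_coeff_summable: "summable (\<lambda>n. diffs (diffs (bessel_coeff \<nu>)) n * z ^ n)"
  by (rule termdiff_converges_all) (rule diffs_bessel_coeff_summable)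

lemma bessel_series_deriv: "(bessel_series \<nu> has_real_derivative bessel_series' \<nu> z) (at z)"
  unfolding bessel_series_def[abs_def] bessel_series'_def
  by (rule termdiffs_strong_converges_everywhere) (rule bessel_coeff_summable)

lemma bessel_series'_deriv: "(bessel_series' \<nu> has_real_derivative bessel_series'' \<nu> z) (at z)"
  unfolding bessel_series'_def[abs_def] bessel_series''_def
  by (rule termdiffs_strong_converges_everywhere) (rule diffs_bessel_coeff_summable)

text \<open>Comparison of coefficients reduces this to \<open>bessel_coeff_Suc\<close>. It is
  Bessel's equation without the factor \<open>(x / 2) powr \<nu>\<close>.\<close>

lemma bessel_series_ode:
  "z * bessel_series'' \<nu> z + (\<nu> + 1) * bessel_series' \<nu> z + bessel_series \<nu> z = 0"
proof -
  have "(\<lambda>n. z * (of_nat n * diffs (bessel_coeff \<nu>) n * z ^ (n - Suc 0))) sums (z * bessel_series'' \<nu> z)"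
    unfolding bessel_series''_def
    by (intro sums_mult diffs_equiv diffs_diffs_bessel_coeff_summable)
  moreover have "z * (of_nat n * diffs (bessel_coeff \<nu>) n * z ^ (n - Suc 0))
      = real n * diffs (bessel_coeff \<nu>) n * z ^ n" for n
    by (cases n) auto
  ultimately have 1: "(\<lambda>n. real n * diffs (bessel_coeff \<nu>) n * z ^ n) sums (z * bessel_series'' \<nu> z)"
    by simp
  have 2: "(\<lambda>n. (\<nu> + 1) * (diffs (bessel_coeff \<nu>) n * z ^ n)) sums ((\<nu> + 1) * bessel_series' \<nu> z)"
    unfolding bessel_series'_def
    by (intro sums_mult summable_sums diffs_bessel_coeff_summable)
  have 3: "(\<lambda>n. bessel_coeff \<nu> n * z ^ n) sums bessel_series \<nu> z"
    unfolding bessel_series_def by (intro summable_sums bessel_coeff_summable)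
  have "real n * diffs (bessel_coeff \<nu>) n * z ^ n + (\<nu> + 1) * (diffs (bessel_coeff \<nu>) n * z ^ n)
      + bessel_coeff \<nu> n * z ^ n
    = ((real n + \<nu> + 1) * (real (Suc n) * bessel_coeff \<nu> (Suc n)) + bessel_coeff \<nu> n) * z ^ n" for n
    by (simp add: diffs_def algebra_simps)
  then have "real n * diffs (bessel_coeff \<nu>) n * z ^ n + (\<nu> + 1) * (diffs (bessel_coeff \<nu>) n * z ^ n)
      + bessel_coeff \<nu> n * z ^ n = 0" for n
    by (simp only: bessel_coeff_Suc) simp
  with sums_add[OF sums_add[OF 1 2] 3] show ?thesis
    by (simp add: sums_0 sums_unique2)
qed

lemma besselJ_eq_series:
  assumes "0 < x"
  shows "besselJ \<nu> x = (x / 2) powr \<nu> * bessel_series \<nu> ((x / 2)\<^sup>2)"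
proof -
  have "(x / 2) powr (2 * real n + \<nu>) = (x / 2) powr \<nu> * ((x / 2)\<^sup>2) ^ n" for n
    using assms powr_realpow[of "x / 2" "2 * n"] by (simp add: powr_add power_mult)
  then have "besselJ \<nu> x = (\<Sum>n. (x / 2) powr \<nu> * (bessel_coeff \<nu> n * ((x / 2)\<^sup>2) ^ n))"
    unfolding besselJ_def bessel_coeff_def by (simp add: algebra_simps)
  also have "\<dots> = (x / 2) powr \<nu> * bessel_series \<nu> ((x / 2)\<^sup>2)"
    unfolding bessel_series_def by (rule suminf_mult) (rule bessel_coeff_summable)
  finally show ?thesis .
qed

end

definition besselJ_log :: "real \<Rightarrow> real \<Rightarrow> real" where
  "besselJ_log \<nu> s = besselJ \<nu> (\<nu> * exp s)"

definition besselJ_log' :: "real \<Rightarrow> real \<Rightarrow> real" where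
  "besselJ_log' \<nu> s = (\<nu> / 2) powr \<nu> * exp (\<nu> * s) *
     (\<nu> * bessel_series \<nu> (\<nu>\<^sup>2 / 4 * exp (2 * s))
       + 2 * (\<nu>\<^sup>2 / 4 * exp (2 * s)) * bessel_series' \<nu> (\<nu>\<^sup>2 / 4 * exp (2 * s)))"

lemma turning_point_besselJ_log:
  assumes nu: "0 < \<nu>"
  shows "turning_point \<nu> (besselJ_log \<nu>) (besselJ_log' \<nu>)"
proof
  define K where "K = (\<nu> / 2) powr \<nu>"
  define Z where "Z = (\<lambda>s. \<nu>\<^sup>2 / 4 * exp (2 * s))"
  have K: "0 < K" using nu by (simp add: K_def)
  have Zd: "(Z has_real_derivative 2 * Z s) (at s)" for s
    unfolding Z_def by (auto intro!: derivative_eq_intros)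
  note G = DERIV_chain2[OF bessel_series_deriv[OF nu] Zd]
  note G' = DERIV_chain2[OF bessel_series'_deriv[OF nu] Zd]
  have v: "besselJ_log \<nu> = (\<lambda>s. K * exp (\<nu> * s) * bessel_series \<nu> (Z s))"
  proof
    fix s
    have "(\<nu> * exp s / 2) powr \<nu> = K * exp (\<nu> * s)"
      using nu powr_mult[of "\<nu> / 2" "exp s" \<nu>] by (simp add: K_def powr_def exp_add mult.commute)
    moreover have "(\<nu> * exp s / 2)\<^sup>2 = Z s"
      by (simp add: Z_def power_divide power_mult_distrib exp_double)
    ultimately show "besselJ_log \<nu> s = K * exp (\<nu> * s) * bessel_series \<nu> (Z s)"
      using nu besselJ_eq_series[OF nu, of "\<nu> * exp s"] by (simp add: besselJ_log_def)
  qed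
  have v': "besselJ_log' \<nu> = (\<lambda>s. K * exp (\<nu> * s) *
      (\<nu> * bessel_series \<nu> (Z s) + 2 * Z s * bessel_series' \<nu> (Z s)))"
    by (rule ext) (simp add: besselJ_log'_def K_def Z_def)
  show "0 < \<nu>" by fact
  show "(besselJ_log \<nu> has_real_derivative besselJ_log' \<nu> s) (at s)" for s
    unfolding v v' by (auto intro!: derivative_eq_intros G simp: algebra_simps)
  show "(besselJ_log' \<nu> has_real_derivative \<nu>\<^sup>2 * (1 - exp (2 * s)) * besselJ_log \<nu> s) (at s)" for s
  proof -
    have "(besselJ_log' \<nu> has_real_derivative K * exp (\<nu> * s) * (\<nu>\<^sup>2 * bessel_series \<nu> (Z s)
       + 4 * Z s * (Z s * bessel_series'' \<nu> (Z s) + (\<nu> + 1) * bessel_series' \<nu> (Z s)))) (at s)"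
      unfolding v'
      by (auto intro!: derivative_eq_intros G G' Zd simp: algebra_simps power2_eq_square)
    \<comment> \<open>The differential equation collapses the bracket to
      \<open>- bessel_series\<close>; the factor \<open>\<nu>\<^sup>2 - 4 * Z s\<close> that results
      is \<open>\<nu>\<^sup>2 * (1 - exp (2 * s))\<close>.\<close>
    also have "Z s * bessel_series'' \<nu> (Z s) + (\<nu> + 1) * bessel_series' \<nu> (Z s) = - bessel_series \<nu> (Z s)"
      using bessel_series_ode[OF nu, of "Z s"] by linarith
    also have "K * exp (\<nu> * s) * (\<nu>\<^sup>2 * bessel_series \<nu> (Z s) + 4 * Z s * - bessel_series \<nu> (Z s))
        = \<nu>\<^sup>2 * (1 - exp (2 * s)) * besselJ_log \<nu> s"
      unfolding v Z_def by (simp add: algebra_simps)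
    finally show ?thesis .
  qed
  have e2: "((\<lambda>t::real. exp (c * t)) \<longlongrightarrow> 0) at_bot" if "0 < c" for c
    by (intro filterlim_compose[OF exp_at_bot] filterlim_tendsto_pos_mult_at_bot[where c=c])
      (use that in \<open>auto simp: filterlim_ident\<close>)
  have Z0: "(Z \<longlongrightarrow> 0) at_bot"
    unfolding Z_def using tendsto_mult_left[OF e2[of 2], of "\<nu>\<^sup>2 / 4"] by simp
  have S: "((\<lambda>s. bessel_series \<nu> (Z s)) \<longlongrightarrow> bessel_series \<nu> 0) at_bot"
    by (rule isCont_tendsto_compose[OF DERIV_isCont[OF bessel_series_deriv[OF nu]] Z0])
  have S': "((\<lambda>s. bessel_series' \<nu> (Z s)) \<longlongrightarrow> bessel_series' \<nu> 0) at_bot"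
    by (rule isCont_tendsto_compose[OF DERIV_isCont[OF bessel_series'_deriv[OF nu]] Z0])
  have "((\<lambda>s. K * exp (\<nu> * s) * bessel_series \<nu> (Z s)) \<longlongrightarrow> K * 0 * bessel_series \<nu> 0) at_bot"
    by (intro tendsto_intros e2 S nu)
  then show "(besselJ_log \<nu> \<longlongrightarrow> 0) at_bot" unfolding v by simp
  have "((\<lambda>s. K * exp (\<nu> * s) * (\<nu> * bessel_series \<nu> (Z s) + 2 * Z s * bessel_series' \<nu> (Z s)))
      \<longlongrightarrow> K * 0 * (\<nu> * bessel_series \<nu> 0 + 2 * 0 * bessel_series' \<nu> 0)) at_bot"
    by (intro tendsto_intros e2 S S' Z0 nu)
  then show "(besselJ_log' \<nu> \<longlongrightarrow> 0) at_bot" unfolding v' by simp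
  \<comment> \<open>The sign near \<open>-\<infinity>\<close> is that of the leading
    coefficient.\<close>
  have "bessel_series \<nu> 0 = 1 / Gamma (\<nu> + 1)"
    unfolding bessel_series_def by (subst powser_zero) (simp add: bessel_coeff_def)
  then have "0 < bessel_series \<nu> 0" using nu by (simp add: Gamma_real_pos)
  from order_tendstoD(1)[OF S this]
  show "eventually (\<lambda>s. 0 < besselJ_log \<nu> s) at_bot"
    unfolding v by eventually_elim (use K in simp)
qed

subsection \<open>Zeros and phase\<close>

lemma nonzero_imp_same_sign:
  fixes u :: "real \<Rightarrow> real"
  assumes "continuous_on {min x y..max x y} u" "\<And>t. t \<in> {min x y..max x y} \<Longrightarrow> u t \<noteq> 0"
  shows "0 < u x * u y"
proof (rule ccontr)
  assume "\<not> 0 < u x * u y"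
  then have "u (min x y) \<le> 0 \<and> 0 \<le> u (max x y) \<or> u (max x y) \<le> 0 \<and> 0 \<le> u (min x y)"
    by (auto simp: min_def max_def zero_less_mult_iff not_less)
  then have "\<exists>t\<ge>min x y. t \<le> max x y \<and> u t = 0"
    using IVT'[of u "min x y" 0 "max x y"] IVT2'[of u "max x y" 0 "min x y"] assms(1)
    by (auto simp: min_def max_def split: if_splits)
  then show False using assms(2) by auto
qed

section \<open>Sturm comparison with equations of constant frequency\<close>

context
  fixes u u' Q :: "real \<Rightarrow> real"
  assumes u: "\<And>s. (u has_real_derivative u' s) (at s)"
    and u': "\<And>s. (u' has_real_derivative - Q s * u s) (at s)"
begin

text \<open>The Wronskian of \<open>u\<close> with the sine wave of frequency \<open>m\<close> that
  vanishes at \<open>a\<close>. The constant \<open>C\<close> will be a value of \<open>u\<close>,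
  so that \<open>C * u s\<close> has a known sign.\<close>

lemma sturm_wronskian_deriv:
  "((\<lambda>s. C * (u' s * sin (m * (s - a)) - m * u s * cos (m * (s - a)))) has_real_derivative
     (m\<^sup>2 - Q s) * (C * u s) * sin (m * (s - a))) (at s)"
  by (auto intro!: derivative_eq_intros u u' simp: algebra_simps power2_eq_square)

lemma sturm_cont: "continuous_on S u"
  by (meson u DERIV_isCont continuous_at_imp_continuous_on)

text \<open>Without a zero, the Wronskian would decrease over one half period of the sine. Its end
  values are \<open>m * (u a' * u b')\<close> and \<open>- m * (u a')\<^sup>2\<close>, which have
  the wrong order.\<close>

lemma sturm_zero_exists:
  assumes m: "0 < m" and Q: "\<And>s. a \<le> s \<Longrightarrow> s \<le> b \<Longrightarrow> m\<^sup>2 \<le> Q s" and len: "pi / m < b - a"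
  shows "\<exists>x. a < x \<and> x < b \<and> u x = 0"
proof (rule ccontr)
  assume no: "\<nexists>x. a < x \<and> x < b \<and> u x = 0"
  \<comment> \<open>The half period is centred strictly inside the interval, so that
    \<open>u\<close> is nonzero at its ends as well.\<close>
  define a' where "a' = (a + b - pi / m) / 2"
  define b' where "b' = a' + pi / m"
  have ab: "a < a'" "a' < b'" "b' < b"
    using len m by (auto simp: a'_def b'_def field_simps)
  have pos: "0 < u a' * u s" if "a' \<le> s" "s \<le> b'" for s
    using no ab that by (intro nonzero_imp_same_sign sturm_cont) auto
  let ?W = "\<lambda>s. u a' * (u' s * sin (m * (s - a')) - m * u s * cos (m * (s - a')))"
  have "?W b' \<le> ?W a'"
  proof (rule DERIV_nonpos_imp_nonincreasing[where f = ?W])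
    fix s assume s: "a' \<le> s" "s \<le> b'"
    have "m * (s - a') \<le> pi" using s m by (simp add: b'_def field_simps)
    then have "0 \<le> sin (m * (s - a'))" using s m by (intro sin_ge_zero) auto
    then have "(m\<^sup>2 - Q s) * (u a' * u s) * sin (m * (s - a')) \<le> 0"
      using Q[of s] s ab pos[OF s] by (intro mult_nonpos_nonneg) auto
    then show "\<exists>D. (?W has_real_derivative D) (at s) \<and> D \<le> 0"
      using sturm_wronskian_deriv by blast
  qed (use ab in simp)
  moreover have "m * (b' - a') = pi" using m by (simp add: b'_def)
  ultimately have "m * (u a' * u b') \<le> - m * (u a' * u a')" by (simp add: algebra_simps)
  moreover have "0 < m * (u a' * u b')" "0 < m * (u a' * u a')"
    using pos[of b'] pos[of a'] ab m by simp_all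
  ultimately show False by simp
qed

text \<open>In a gap shorter than \<open>pi / M\<close> the sine is positive and the Wronskian
  increases from 0. Then \<open>u'\<close> at \<open>b\<close> has the sign that \<open>u\<close>
  has in the gap, whereas \<open>u\<close> must come back to zero there.\<close>

lemma sturm_gap_ge:
  assumes M: "0 < M" and Q: "\<And>s. a \<le> s \<Longrightarrow> s \<le> b \<Longrightarrow> Q s \<le> M\<^sup>2"
    and ab: "a < b" "u a = 0" "u b = 0" "u' b \<noteq> 0" "\<And>s. a < s \<Longrightarrow> s < b \<Longrightarrow> u s \<noteq> 0"
  shows "pi / M \<le> b - a"
proof (rule ccontr)
  assume "\<not> pi / M \<le> b - a"
  then have len: "M * (b - a) < pi" using M by (simp add: field_simps)
  define c where "c = (a + b) / 2"
  have c: "a < c" "c < b" using ab by (auto simp: c_def)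
  have pos: "0 < u c * u s" if "a < s" "s < b" for s
    using ab that c by (intro nonzero_imp_same_sign sturm_cont) auto
  have pos': "0 \<le> u c * u s" if "a \<le> s" "s \<le> b" for s
    using pos[of s] that ab by (cases "s = a \<or> s = b") auto
  let ?W = "\<lambda>s. u c * (u' s * sin (M * (s - a)) - M * u s * cos (M * (s - a)))"
  have "?W a \<le> ?W b"
  proof (rule DERIV_nonneg_imp_nondecreasing[where f = ?W])
    fix s assume s: "a \<le> s" "s \<le> b"
    have "M * (s - a) \<le> M * (b - a)" using s M by simp
    then have "M * (s - a) \<le> pi" using len by linarith
    then have "0 \<le> sin (M * (s - a))" using s M by (intro sin_ge_zero) auto
    then have "0 \<le> (M\<^sup>2 - Q s) * (u c * u s) * sin (M * (s - a))"
      using Q[OF s] pos'[OF s]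
      by (intro mult_nonneg_nonneg[OF mult_nonneg_nonneg]) simp_all
    then show "\<exists>D. (?W has_real_derivative D) (at s) \<and> 0 \<le> D"
      using sturm_wronskian_deriv by blast
  qed (use ab in simp)
  then have "0 \<le> u c * u' b * sin (M * (b - a))" using ab by simp
  moreover have "0 < sin (M * (b - a))" using len M ab by (intro sin_gt_zero) auto
  ultimately have "0 \<le> u c * u' b" by (simp add: zero_le_mult_iff)
  moreover have "u c \<noteq> 0" using pos[of c] c by auto
  ultimately have "0 < u c * u' b" using ab(4) by (simp add: less_le)
  moreover have "((\<lambda>s. u c * u s) has_real_derivative u c * u' b) (at b)"
    by (auto intro!: derivative_eq_intros u)
  ultimately obtain d where d: "0 < d" "\<And>t. 0 < t \<Longrightarrow> t < d \<Longrightarrow> u c * u (b - t) < u c * u b"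
    using DERIV_pos_inc_left by blast
  define t where "t = min (d / 2) ((b - a) / 2)"
  have "0 < t" "t < d" "a < b - t" "b - t < b" using d ab by (auto simp: t_def min_def field_simps)
  then show False using d(2)[of t] pos[of "b - t"] ab by auto
qed

end

section \<open>The phase function\<close>

text \<open>The antiderivative of \<open>sqrt (exp (2 * s) - 1)\<close> on \<open>s > 0\<close>. At \<open>s = ln h\<close> it equals
  \<open>sqrt (h\<^sup>2 - 1) - arccos (1 / h)\<close>, so that \<open>hfun w\<close> is the point where the phase is \<open>pi / w\<close>.\<close>

definition wkb_phase :: "real \<Rightarrow> real" where
  "wkb_phase s = sqrt (exp (2 * s) - 1) - arctan (sqrt (exp (2 * s) - 1))"

lemma wkb_phase_deriv:
  assumes "0 < s"
  shows "(wkb_phase has_real_derivative sqrt (exp (2 * s) - 1)) (at s)"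
proof -
  define g where "g = sqrt (exp (2 * s) - 1)"
  have g: "0 < g" "g\<^sup>2 = exp (2 * s) - 1" using assms by (auto simp: g_def)
  have G: "((\<lambda>s. sqrt (exp (2 * s) - 1)) has_real_derivative exp (2 * s) / g) (at s)"
    unfolding g_def using assms by (auto intro!: derivative_eq_intros simp: field_simps)
  have "(wkb_phase has_real_derivative exp (2 * s) / g - inverse (1 + g\<^sup>2) * (exp (2 * s) / g)) (at s)"
    unfolding wkb_phase_def[abs_def] g_def
    by (rule DERIV_diff DERIV_chain2[OF DERIV_arctan] G[unfolded g_def])+
  moreover have "exp (2 * s) / g - inverse (1 + g\<^sup>2) * (exp (2 * s) / g) = g"
    using g by (simp add: field_simps power2_eq_square)
  ultimately show ?thesis by (simp add: g_def)
qed

lemma wkb_phase_continuous: "continuous_on S wkb_phase"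
  unfolding wkb_phase_def[abs_def] by (intro continuous_intros)

lemma wkb_phase_diff:
  assumes "0 \<le> a" "a < b"
  obtains x where "a < x" "x < b" "wkb_phase b - wkb_phase a = (b - a) * sqrt (exp (2 * x) - 1)"
proof -
  have "\<exists>l z. a < z \<and> z < b \<and> (wkb_phase has_real_derivative l) (at z) \<and> wkb_phase b - wkb_phase a = (b - a) * l"
    using assms by (intro MVT wkb_phase_continuous)
      (auto simp: real_differentiable_def intro!: exI wkb_phase_deriv)
  then obtain l z where z: "a < z" "z < b" "(wkb_phase has_real_derivative l) (at z)"
    "wkb_phase b - wkb_phase a = (b - a) * l" by auto
  have "l = sqrt (exp (2 * z) - 1)"
    using z assms by (intro DERIV_unique[OF z(3) wkb_phase_deriv]) auto
  then show ?thesis using that z by blast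
qed

lemma wkb_phase_0: "wkb_phase 0 = 0"
  by (simp add: wkb_phase_def)

lemma wkb_phase_strict_mono:
  assumes "0 \<le> a" "a < b" shows "wkb_phase a < wkb_phase b"
proof -
  obtain x where x: "a < x" "x < b" "wkb_phase b - wkb_phase a = (b - a) * sqrt (exp (2 * x) - 1)"
    using wkb_phase_diff[OF assms] .
  have "0 < (b - a) * sqrt (exp (2 * x) - 1)" using x assms by (intro mult_pos_pos) auto
  then show ?thesis using x by simp
qed

lemma wkb_phase_ge: "sqrt (exp (2 * s) - 1) - pi / 2 \<le> wkb_phase s"
  unfolding wkb_phase_def using arctan_ubound[of "sqrt (exp (2 * s) - 1)"] by simp

section \<open>Counting zeros by the phase\<close>

context turning_point
begin

lemma v_sturm: "(v' has_real_derivative - (\<nu>\<^sup>2 * (exp (2 * s) - 1)) * v s) (at s)"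
  using v'_deriv[of s] by (simp add: algebra_simps)

lemma zero_pos: "v s = 0 \<Longrightarrow> 0 < s"
  using v_pos[of s] by (cases "s \<le> 0") auto

text \<open>The energy \<open>v'\<^sup>2 + \<nu>\<^sup>2 q v\<^sup>2\<close> is nonnegative at 0,
  rises strictly just after 0 because \<open>v 0\<close> is positive, and never decreases. At a
  double zero it would vanish.\<close>

lemma v'_nonzero:
  assumes "v s = 0" shows "v' s \<noteq> 0"
proof
  assume v's: "v' s = 0"
  let ?E = "\<lambda>t. (v' t)\<^sup>2 + \<nu>\<^sup>2 * (exp (2 * t) - 1) * (v t)\<^sup>2"
  have E: "(?E has_real_derivative 2 * \<nu>\<^sup>2 * exp (2 * t) * (v t)\<^sup>2) (at t)" for t
    by (auto intro!: derivative_eq_intros v_deriv v'_deriv simp: power2_eq_square algebra_simps)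
  have "0 < 2 * \<nu>\<^sup>2 * exp (2 * 0) * (v 0)\<^sup>2" using nu_pos v_pos[of 0] by simp
  then obtain d where d: "0 < d" "\<And>t. 0 < t \<Longrightarrow> t < d \<Longrightarrow> ?E 0 < ?E (0 + t)"
    using DERIV_pos_inc_right[OF E] by blast
  have s: "0 < s" using zero_pos assms by simp
  define t where "t = min (d / 2) s"
  have t: "0 < t" "t < d" "t \<le> s" using d s by (auto simp: t_def)
  have "?E t \<le> ?E s"
    by (rule DERIV_nonneg_imp_nondecreasing[OF t(3)]) (use E in \<open>meson mult_nonneg_nonneg zero_le_power2 exp_ge_zero zero_le_numeral\<close>)
  moreover have "?E 0 < ?E t" using d(2)[OF t(1,2)] by simp
  moreover have "0 \<le> ?E 0" by simp
  ultimately show False using assms v's by simp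
qed

text \<open>Zeros are positive, so infinitely many below \<open>b\<close> would accumulate. The
  limit point would be a zero with vanishing derivative.\<close>

lemma zeros_finite: "finite {s. s \<le> b \<and> v s = 0}"
proof (rule ccontr)
  let ?T = "{s. s \<le> b \<and> v s = 0}"
  assume "infinite ?T"
  moreover have "?T \<subseteq> {0..b}" using zero_pos by force
  ultimately obtain x where x: "x islimpt ?T"
    using Heine_Borel_imp_Bolzano_Weierstrass[of "{0..b}" ?T] by auto
  have "closed {s. v s = 0}"
    using continuous_closed_vimage[of "{0}" v] v_deriv DERIV_isCont
    by (auto simp: vimage_def)
  moreover have "x islimpt {s. v s = 0}" using x by (rule islimpt_subset) auto
  ultimately have vx: "v x = 0" by (auto simp: closed_limpt)
  have "((\<lambda>y. (v y - v x) / (y - x)) \<longlongrightarrow> v' x) (at x)"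
    using v_deriv[of x] by (simp add: has_field_derivative_iff)
  then have "eventually (\<lambda>y. (v y - v x) / (y - x) \<noteq> 0) (at x)"
    using v'_nonzero[OF vx] by (rule tendsto_imp_eventually_ne)
  then have "eventually (\<lambda>y. y \<notin> ?T) (at x)"
    by eventually_elim (use vx in auto)
  then show False using x by (simp add: islimpt_iff_eventually)
qed

lemma next_zero:
  obtains z where "a < z" "v z = 0" "\<And>y. a < y \<Longrightarrow> y < z \<Longrightarrow> v y \<noteq> 0"
proof -
  \<comment> \<open>Beyond 1 the coefficient is at least \<open>\<nu>\<^sup>2 * (exp 2 - 1)\<close>,
    so Sturm comparison yields a zero; the least one follows by finiteness.\<close>
  define a' where "a' = max a 1"
  define m where "m = \<nu> * sqrt (exp 2 - 1)"
  have m: "0 < m" using nu_pos by (simp add: m_def)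
  have "\<exists>x. a' < x \<and> x < a' + pi / m + 1 \<and> v x = 0"
  proof (rule sturm_zero_exists[OF v_deriv v_sturm m])
    fix s assume "a' \<le> s"
    then show "m\<^sup>2 \<le> \<nu>\<^sup>2 * (exp (2 * s) - 1)"
      using nu_pos by (simp add: m_def a'_def power_mult_distrib)
  qed simp
  then obtain x where x: "a < x" "v x = 0" by (auto simp: a'_def)
  let ?S = "{s. s \<le> x \<and> v s = 0} \<inter> {a<..}"
  have S: "finite ?S" "?S \<noteq> {}" using zeros_finite x by auto
  have "Min ?S \<in> ?S" using Min_in[OF S] .
  moreover have "v y \<noteq> 0" if "a < y" "y < Min ?S" for y
  proof
    assume "v y = 0"
    moreover have "y \<le> x" using that(2) Min_le[OF S(1), of x] x by simp
    ultimately show False using Min_le[OF S(1), of y] that by simp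
  qed
  ultimately show ?thesis by (intro that[of "Min ?S"]) auto
qed

text \<open>Zeros are indexed by the number of zeros below them, so index \<open>k\<close> denotes
  the zero of number \<open>k + 1\<close>.\<close>

lemma kth_zero_exists: "\<exists>z. v z = 0 \<and> card {y. y < z \<and> v y = 0} = k"
proof (induction k)
  case 0
  obtain z where z: "0 < z" "v z = 0" "\<And>y. 0 < y \<Longrightarrow> y < z \<Longrightarrow> v y \<noteq> 0"
    using next_zero[of 0] by blast
  then have "{y. y < z \<and> v y = 0} = {}" using zero_pos by force
  then show ?case using z by (metis card.empty)
next
  case (Suc k)
  then obtain a where a: "v a = 0" "card {y. y < a \<and> v y = 0} = k" by auto
  obtain z where z: "a < z" "v z = 0" "\<And>y. a < y \<Longrightarrow> y < z \<Longrightarrow> v y \<noteq> 0"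
    using next_zero[of a] by blast
  have "{y. y < z \<and> v y = 0} = insert a {y. y < a \<and> v y = 0}"
    using z a by (auto, meson linorder_cases)
  moreover have "finite {y. y < a \<and> v y = 0}"
    by (rule finite_subset[OF _ zeros_finite[of a]]) auto
  ultimately show ?case using a z by (intro exI[of _ z]) simp
qed

lemma kth_zero_unique:
  assumes "v z1 = 0" "v z2 = 0" "card {y. y < z1 \<and> v y = 0} = card {y. y < z2 \<and> v y = 0}"
  shows "z1 = z2"
proof -
  have less: "card {y. y < a \<and> v y = 0} < card {y. y < b \<and> v y = 0}"
    if "a < b" "v a = 0" for a b
    by (rule psubset_card_mono)
      (use that in \<open>auto intro: finite_subset[OF _ zeros_finite[of b]]\<close>)
  show ?thesis
    using less[of z1 z2] less[of z2 z1] assms by (cases z1 z2 rule: linorder_cases) auto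
qed

text \<open>The frequency degenerates at the turning point. A length \<open>d\<close> is given away
  so that it is bounded below on the rest of the gap.\<close>

lemma gap_le:
  assumes "0 < d" "0 \<le> a" "\<And>y. a < y \<Longrightarrow> y < b \<Longrightarrow> v y \<noteq> 0"
  shows "b - a \<le> d + pi / (\<nu> * sqrt (exp (2 * d) - 1))"
proof (rule ccontr)
  assume "\<not> ?thesis"
  then have len: "pi / (\<nu> * sqrt (exp (2 * d) - 1)) < b - (a + d)" by simp
  have "\<exists>x. a + d < x \<and> x < b \<and> v x = 0"
  proof (rule sturm_zero_exists[OF v_deriv v_sturm _ _ len])
    show "0 < \<nu> * sqrt (exp (2 * d) - 1)" using nu_pos assms by simp
    show "(\<nu> * sqrt (exp (2 * d) - 1))\<^sup>2 \<le> \<nu>\<^sup>2 * (exp (2 * s) - 1)" if "a + d \<le> s" for s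
      using nu_pos assms that by (simp add: power_mult_distrib)
  qed
  then show False using assms by force
qed

text \<open>Sturm comparison from both sides places \<open>pi / \<nu>\<close> between
  \<open>b - a\<close> times the values of \<open>sqrt q\<close> at \<open>a\<close> and at
  \<open>b\<close>; the phase increment lies there too. The bound is a difference in
  \<open>sqrt q\<close>, so that it telescopes over the gaps.\<close>

lemma phase_gap:
  assumes "0 < d" "v a = 0" "v b = 0" "a < b" "\<And>y. a < y \<Longrightarrow> y < b \<Longrightarrow> v y \<noteq> 0"
  shows "\<bar>pi / \<nu> - (wkb_phase b - wkb_phase a)\<bar> \<le>
    (d + pi / (\<nu> * sqrt (exp (2 * d) - 1))) * (sqrt (exp (2 * b) - 1) - sqrt (exp (2 * a) - 1))"
proof -
  have a0: "0 < a" using assms zero_pos by simp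
  obtain x where x: "a < x" "x < b" "wkb_phase b - wkb_phase a = (b - a) * sqrt (exp (2 * x) - 1)"
    using wkb_phase_diff[of a b] a0 assms by auto
  let ?q = "\<lambda>s::real. sqrt (exp (2 * s) - 1)"
  have qa: "0 < ?q a" and qb: "0 < ?q b" using a0 assms by auto
  have "pi / (\<nu> * ?q b) \<le> b - a"
    by (rule sturm_gap_ge[OF v_deriv v_sturm])
      (use nu_pos qb assms v'_nonzero a0 in \<open>auto simp: power_mult_distrib\<close>)
  then have 1: "pi / \<nu> \<le> (b - a) * ?q b" using qb nu_pos by (simp add: field_simps)
  have "b - a \<le> pi / (\<nu> * ?q a)"
  proof (rule ccontr)
    assume "\<not> b - a \<le> pi / (\<nu> * ?q a)"
    then have len: "pi / (\<nu> * ?q a) < b - a" by simp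
    have "\<exists>x. a < x \<and> x < b \<and> v x = 0"
      by (rule sturm_zero_exists[OF v_deriv v_sturm _ _ len])
        (use nu_pos qa a0 in \<open>auto simp: power_mult_distrib\<close>)
    then show False using assms by blast
  qed
  then have 2: "(b - a) * ?q a \<le> pi / \<nu>" using qa nu_pos by (simp add: field_simps)
  have 3: "(b - a) * ?q a \<le> (b - a) * ?q x" "(b - a) * ?q x \<le> (b - a) * ?q b"
    using assms x a0 by (auto intro!: mult_left_mono)
  have "\<bar>pi / \<nu> - (wkb_phase b - wkb_phase a)\<bar> \<le> (b - a) * (?q b - ?q a)"
    unfolding x(3) using 1 2 3 by (simp add: right_diff_distrib abs_le_iff)
  also have "\<dots> \<le> (d + pi / (\<nu> * ?q d)) * (?q b - ?q a)"
    using gap_le[of d a b] assms a0 by (intro mult_right_mono) auto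
  finally show ?thesis .
qed

text \<open>The errors of \<open>phase_gap\<close> telescope over consecutive zeros. The stretch
  from 0 to the first zero is not such a gap; it is estimated crudely and causes the extra
  \<open>pi / \<nu>\<close>.\<close>

lemma kth_zero_phase:
  assumes "0 < d" "v z = 0" "card {y. y < z \<and> v y = 0} = k"
  shows "\<bar>real (Suc k) * pi / \<nu> - wkb_phase z\<bar> \<le>
    pi / \<nu> + (d + pi / (\<nu> * sqrt (exp (2 * d) - 1))) * sqrt (exp (2 * z) - 1)"
  using assms(2,3)
proof (induction k arbitrary: z)
  case 0
  let ?q = "\<lambda>s::real. sqrt (exp (2 * s) - 1)"
  have z: "0 < z" using zero_pos 0 by simp
  \<comment> \<open>Finiteness is what turns cardinality 0 into emptiness.\<close>
  have "finite {y. y < z \<and> v y = 0}"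
    by (rule finite_subset[OF _ zeros_finite[of z]]) auto
  then have no: "v y \<noteq> 0" if "y < z" for y using 0 that by auto
  obtain x where x: "0 < x" "x < z" "wkb_phase z - wkb_phase 0 = (z - 0) * ?q x"
    using wkb_phase_diff[of 0 z] z by auto
  have "z \<le> d + pi / (\<nu> * ?q d)" using gap_le[of d 0 z] assms(1) no by auto
  then have "z * ?q x \<le> (d + pi / (\<nu> * ?q d)) * ?q z"
    using x z by (intro mult_mono) auto
  moreover have "0 \<le> z * ?q x" using x z by auto
  moreover have "0 \<le> pi / \<nu>" using nu_pos by simp
  ultimately show ?case using x(3) wkb_phase_0
    by (simp only: of_nat_Suc of_nat_0 add_0_right mult_1 diff_0_right)
next
  case (Suc k)
  let ?q = "\<lambda>s::real. sqrt (exp (2 * s) - 1)"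
  let ?S = "{y. y < z \<and> v y = 0}"
  have S: "finite ?S" by (rule finite_subset[OF _ zeros_finite[of z]]) auto
  have ne: "?S \<noteq> {}" using Suc.prems by (metis card.empty nat.distinct(1))
  define a where "a = Max ?S"
  have "a \<in> ?S" using Max_in[OF S ne] by (simp add: a_def)
  then have a: "a < z" "v a = 0" by auto
  have no: "v y \<noteq> 0" if "a < y" "y < z" for y
    using Max_ge[OF S, of y] that by (auto simp: a_def[symmetric])
  have eq: "?S = insert a {y. y < a \<and> v y = 0}"
    using a no by (auto, meson linorder_cases)
  have "finite {y. y < a \<and> v y = 0}"
    by (rule finite_subset[OF _ zeros_finite[of a]]) auto
  then have "card {y. y < a \<and> v y = 0} = k" using Suc.prems unfolding eq by simp
  from Suc.IH[OF a(2) this] phase_gap[OF assms(1) a(2) Suc.prems(1) a(1) no]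
  show ?case
    unfolding right_diff_distrib of_nat_Suc[of "Suc k"] add_divide_distrib distrib_right by linarith
qed

end

text \<open>The error contains \<open>sqrt q\<close> at the zero itself, which is first shown to be
  bounded; then \<open>d\<close> can be taken arbitrarily small.\<close>

lemma wkb_phase_tendsto:
  fixes \<nu> z K :: "nat \<Rightarrow> real"
  assumes nu: "filterlim \<nu> at_top sequentially" and K: "K \<longlonglongrightarrow> L"
    and z: "eventually (\<lambda>n. 0 < z n) sequentially"
    and est: "\<And>d. 0 < d \<Longrightarrow> eventually (\<lambda>n. \<bar>K n - wkb_phase (z n)\<bar> \<le>
      pi / \<nu> n + (d + pi / (\<nu> n * sqrt (exp (2 * d) - 1))) * sqrt (exp (2 * z n) - 1)) sequentially"
  shows "(\<lambda>n. wkb_phase (z n)) \<longlonglongrightarrow> L"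
proof -
  let ?q = "\<lambda>s::real. sqrt (exp (2 * s) - 1)"
  have pn: "(\<lambda>n. pi / \<nu> n) \<longlonglongrightarrow> 0"
    using tendsto_divide_0[OF tendsto_const filterlim_at_top_imp_at_infinity[OF nu]] .
  have pq: "(\<lambda>n. pi / (\<nu> n * c)) \<longlonglongrightarrow> 0" for c
    using tendsto_mult_left[OF pn, of "1 / c"] by (simp add: field_simps)
  \<comment> \<open>With \<open>d = 1/4\<close> the error is eventually at most
    \<open>1 + sqrt q / 2\<close>, while the phase is at least \<open>sqrt q - pi / 2\<close>.
    Solving for \<open>sqrt q\<close> gives this bound.\<close>
  define B where "B = 2 * \<bar>L\<bar> + 8"
  have B: "0 < B" by (simp add: B_def)
  have bound: "eventually (\<lambda>n. ?q (z n) \<le> B) sequentially"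
  proof -
    have "eventually (\<lambda>n. pi / (\<nu> n * ?q (1/4)) < 1/4) sequentially"
      using order_tendstoD(2)[OF pq[of "?q (1/4)"], of "1/4"] by simp
    moreover have "eventually (\<lambda>n. pi / \<nu> n < 1) sequentially"
      using order_tendstoD(2)[OF pn, of 1] by simp
    moreover have "eventually (\<lambda>n. K n < \<bar>L\<bar> + 1) sequentially"
      using order_tendstoD(2)[OF K, of "\<bar>L\<bar> + 1"] by simp
    moreover have "eventually (\<lambda>n. \<bar>K n - wkb_phase (z n)\<bar> \<le>
      pi / \<nu> n + (1/4 + pi / (\<nu> n * ?q (1/4))) * ?q (z n)) sequentially"
      using est[of "1/4"] by simp
    ultimately show ?thesis using z
    proof eventually_elim
      case (elim n)
      have "(1/4 + pi / (\<nu> n * ?q (1/4))) * ?q (z n) \<le> 1/2 * ?q (z n)"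
      proof (rule mult_right_mono)
        show "1/4 + pi / (\<nu> n * ?q (1/4)) \<le> 1/2" using elim(1) by linarith
      qed (use elim in simp)
      then show ?case
        using elim wkb_phase_ge[of "z n"] pi_less_4 unfolding B_def by linarith
    qed
  qed
  have "(\<lambda>n. K n - wkb_phase (z n)) \<longlonglongrightarrow> 0"
  proof (rule tendstoI)
    fix e :: real assume e: "0 < e"
    define d where "d = e / (2 * B)"
    have d: "0 < d" using e B by (simp add: d_def)
    have lim: "(\<lambda>n. pi / \<nu> n + pi / (\<nu> n * ?q d) * B) \<longlonglongrightarrow> 0 + 0 * B"
      by (intro tendsto_intros pn pq)
    have "eventually (\<lambda>n. pi / \<nu> n + pi / (\<nu> n * ?q d) * B < e / 2) sequentially"
      by (rule order_tendstoD(2)[OF lim]) (use e in simp)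
    then show "eventually (\<lambda>n. dist (K n - wkb_phase (z n)) 0 < e) sequentially"
      using est[OF d] bound filterlim_at_top_dense[THEN iffD1, OF nu, rule_format, of 0]
    proof eventually_elim
      case (elim n)
      have "(d + pi / (\<nu> n * ?q d)) * ?q (z n) \<le> (d + pi / (\<nu> n * ?q d)) * B"
        using elim d by (intro mult_left_mono) auto
      also have "\<dots> = e / 2 + pi / (\<nu> n * ?q d) * B"
        using B by (simp add: d_def field_simps)
      finally show ?case unfolding dist_real_def using elim(1,2) by linarith
    qed
  qed
  from tendsto_diff[OF K this] show ?thesis by simp
qed

lemma wkb_phase_surj:
  assumes "0 < L" shows "\<exists>s>0. wkb_phase s = L"
proof -
  \<comment> \<open>At \<open>s = ln (b + 1)\<close> the root \<open>sqrt q\<close> is at least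
    \<open>b = L + pi\<close>, and the phase falls short of it by at most
    \<open>pi / 2\<close>.\<close>
  define b where "b = L + pi"
  have b0: "0 < b" unfolding b_def using assms pi_gt_zero by linarith
  have "\<exists>s\<ge>0. s \<le> ln (b + 1) \<and> wkb_phase s = L"
  proof (rule IVT')
    have "b \<le> sqrt (exp (2 * ln (b + 1)) - 1)"
    proof (rule real_le_rsqrt)
      have "exp (2 * ln (b + 1)) = (b + 1)\<^sup>2" using b0 by (simp add: exp_double)
      then show "b\<^sup>2 \<le> exp (2 * ln (b + 1)) - 1" using b0 by (simp add: power2_eq_square algebra_simps)
    qed
    then show "L \<le> wkb_phase (ln (b + 1))"
      using wkb_phase_ge[of "ln (b + 1)"] pi_gt_zero b_def by linarith
  qed (use assms b0 wkb_phase_0 wkb_phase_continuous in auto)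
  then obtain s where "0 \<le> s" "wkb_phase s = L" by auto
  then show ?thesis using assms wkb_phase_0 by (intro exI[of _ s]) (auto simp: less_le)
qed

lemma wkb_phase_inverse_tendsto:
  assumes "0 < s" "(\<lambda>n. wkb_phase (z n)) \<longlonglongrightarrow> wkb_phase s"
    and "eventually (\<lambda>n. 0 < z n) sequentially"
  shows "z \<longlonglongrightarrow> s"
proof (rule order_tendstoI)
  fix a assume a: "a < s"
  then have "wkb_phase (max a 0) < wkb_phase s" using assms by (intro wkb_phase_strict_mono) auto
  from order_tendstoD(1)[OF assms(2) this] assms(3)
  show "eventually (\<lambda>n. a < z n) sequentially"
  proof eventually_elim
    case (elim n)
    then show ?case using wkb_phase_strict_mono[of "z n" a] by (cases "z n = a") force+
  qed
next
  fix a assume a: "s < a"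
  then have "wkb_phase s < wkb_phase a" using assms by (intro wkb_phase_strict_mono) auto
  from order_tendstoD(2)[OF assms(2) this] assms(3)
  show "eventually (\<lambda>n. z n < a) sequentially"
  proof eventually_elim
    case (elim n)
    then show ?case using wkb_phase_strict_mono[of a "z n"] assms a by (cases "z n = a") force+
  qed
qed

text \<open>The substitution \<open>h = exp s\<close> and
  \<open>arccos (1 / h) = arctan (sqrt (h\<^sup>2 - 1))\<close> turn the equation for
  \<open>h\<close> into one for the phase, which is injective.\<close>

lemma hfun_eq:
  assumes "0 < w" "0 < s" "wkb_phase s = pi / w"
  shows "hfun w = exp s"
proof -
  have *: "sqrt (h\<^sup>2 - 1) - arccos (1 / h) = wkb_phase (ln h)" if "1 < h" for h
  proof -
    define g where "g = sqrt (h\<^sup>2 - 1)"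
    have "1 < h\<^sup>2" using that by (simp add: one_less_power)
    then have g: "0 < g" "g\<^sup>2 = h\<^sup>2 - 1" by (auto simp: g_def)
    have "exp (2 * ln h) = h\<^sup>2" using that by (simp add: exp_double)
    moreover have "arccos (1 / h) = arctan g"
    proof -
      have "cos (arctan g) = 1 / h" using g that by (simp add: cos_arctan)
      moreover have "0 \<le> arctan g" "arctan g \<le> pi"
        using g arctan_ubound[of g] pi_gt_zero by (simp, linarith)
      ultimately show ?thesis using arccos_cos[of "arctan g"] by simp
    qed
    ultimately show ?thesis by (simp add: wkb_phase_def g_def)
  qed
  show ?thesis unfolding hfun_def
  proof (rule the_equality)
    show "1 < exp s \<and> sqrt ((exp s)\<^sup>2 - 1) - arccos (1 / exp s) = pi / w"
      using *[of "exp s"] assms by simp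
  next
    fix h assume h: "1 < h \<and> sqrt (h\<^sup>2 - 1) - arccos (1 / h) = pi / w"
    then have "wkb_phase (ln h) = wkb_phase s" using *[of h] assms by simp
    moreover have "0 < ln h" using h by simp
    ultimately have "ln h = s"
      using wkb_phase_strict_mono[of "ln h" s] wkb_phase_strict_mono[of s "ln h"] assms
      by (cases "ln h" s rule: linorder_cases) auto
    then show "h = exp s" using h by auto
  qed
qed

subsection \<open>Homogeneous functions and Lp norms\<close>

text \<open>Dilation takes the place of polar coordinates: the integral over the unit ball stands
  for the angular integral, up to the factor \<open>d\<close>.\<close>

lemma nn_integral_ball_homogeneous:
  fixes g :: "'a::euclidean_space \<Rightarrow> ennreal"
  assumes [measurable]: "g \<in> borel_measurable borel"
    and hom: "\<And>t x. 0 < t \<Longrightarrow> g (t *\<^sub>R x) = g x" and r: "0 < r"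
  shows "(\<integral>\<^sup>+x\<in>ball 0 r. g x \<partial>lborel) = ennreal (r ^ DIM('a)) * (\<integral>\<^sup>+x\<in>ball 0 1. g x \<partial>lborel)"
proof -
  have [measurable]: "ball (0::'a) s \<in> sets borel" for s by simp
  have ind: "indicator (ball 0 r) (r *\<^sub>R x) = (indicator (ball 0 1) x :: ennreal)" for x :: 'a
    using r by (auto simp: indicator_def abs_mult)
  have "(\<integral>\<^sup>+x\<in>ball 0 r. g x \<partial>lborel)
      = (\<integral>\<^sup>+x\<in>ball 0 r. g x \<partial>(density (distr lborel borel (\<lambda>x. 0 + r *\<^sub>R x)) (\<lambda>_. ennreal (\<bar>r\<bar> ^ DIM('a)))))"
    using lborel_affine[of r "0::'a"] r by simp
  also have "\<dots> = (\<integral>\<^sup>+x. ennreal (\<bar>r\<bar> ^ DIM('a)) * (g (r *\<^sub>R x) * indicator (ball 0 r) (r *\<^sub>R x)) \<partial>lborel)"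
    by (subst nn_integral_density, measurable, subst nn_integral_distr, measurable)
  also have "\<dots> = (\<integral>\<^sup>+x. ennreal (r ^ DIM('a)) * (g x * indicator (ball 0 1) x) \<partial>lborel)"
    using r by (simp add: ind hom)
  also have "\<dots> = ennreal (r ^ DIM('a)) * (\<integral>\<^sup>+x\<in>ball 0 1. g x \<partial>lborel)"
    by (rule nn_integral_cmult) measurable
  finally show ?thesis .
qed

lemma nn_integral_annulus_homogeneous:
  fixes g :: "'a::euclidean_space \<Rightarrow> ennreal"
  assumes g [measurable]: "g \<in> borel_measurable borel"
    and hom: "\<And>t x. 0 < t \<Longrightarrow> g (t *\<^sub>R x) = g x"
    and fin: "(\<integral>\<^sup>+x\<in>ball 0 1. g x \<partial>lborel) < \<infinity>"
    and ab: "0 < a" "a \<le> b"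
  shows "(\<integral>\<^sup>+x\<in>ball 0 b - ball 0 a. g x \<partial>lborel)
    = ennreal (b ^ DIM('a) - a ^ DIM('a)) * (\<integral>\<^sup>+x\<in>ball 0 1. g x \<partial>lborel)"
proof -
  have [measurable]: "ball (0::'a) s \<in> sets borel" for s by simp
  let ?C = "\<integral>\<^sup>+x\<in>ball 0 1. g x \<partial>lborel"
  let ?A = "\<integral>\<^sup>+x\<in>ball 0 b - ball 0 a. g x \<partial>lborel"
  have le: "a ^ DIM('a) \<le> b ^ DIM('a)" using ab by (intro power_mono) auto
  have "ennreal (b ^ DIM('a)) * ?C = (\<integral>\<^sup>+x\<in>ball 0 b. g x \<partial>lborel)"
    using ab by (intro nn_integral_ball_homogeneous[symmetric] g hom) auto
  also have "\<dots> = (\<integral>\<^sup>+x. g x * indicator (ball 0 a) x + g x * indicator (ball 0 b - ball 0 a) x \<partial>lborel)"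
    by (intro nn_integral_cong) (use ab in \<open>auto simp: indicator_def\<close>)
  also have "\<dots> = (\<integral>\<^sup>+x\<in>ball 0 a. g x \<partial>lborel) + ?A"
    by (rule nn_integral_add) measurable
  also have "(\<integral>\<^sup>+x\<in>ball 0 a. g x \<partial>lborel) = ennreal (a ^ DIM('a)) * ?C"
    using ab by (intro nn_integral_ball_homogeneous g hom) auto
  finally have "ennreal (a ^ DIM('a)) * ?C + ?A
      = ennreal (a ^ DIM('a)) * ?C + ennreal (b ^ DIM('a) - a ^ DIM('a)) * ?C"
    using le ab by (simp flip: distrib_right ennreal_plus)
  \<comment> \<open>Cancellation in \<open>ennreal\<close> requires a finite summand.\<close>
  moreover have "ennreal (a ^ DIM('a)) * ?C \<noteq> \<infinity>"
    using fin by (simp add: ennreal_mult_eq_top_iff less_top)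
  ultimately show ?thesis by (simp add: ennreal_add_left_cancel)
qed

text \<open>The angular integral occurs in the upper bound of the numerator and in the lower bound
  of the denominator and cancels, so the estimate is uniform in the spherical harmonic. The bound
  \<open>B\<close> makes this integral finite.\<close>

lemma Lp_norm_ratio_le:
  fixes f y :: "real^'n::finite \<Rightarrow> real" and R :: "real \<Rightarrow> real"
  assumes p: "0 < p" and y [measurable]: "y \<in> borel_measurable borel"
    and hom: "\<And>t x. 0 < t \<Longrightarrow> y (t *\<^sub>R x) = y x" and bdd: "\<And>x. \<bar>y x\<bar> \<le> B"
    and f: "\<And>x. f x = R (norm x) * y x"
    and S: "S \<subseteq> ball 0 1" and M: "0 \<le> M" "\<And>x. x \<in> S \<Longrightarrow> \<bar>R (norm x)\<bar> \<le> M"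
    and m: "0 < m" "\<And>r. a \<le> r \<Longrightarrow> r < b \<Longrightarrow> m \<le> \<bar>R r\<bar>" and ab: "0 < a" "a < b" "b \<le> 1"
  shows "Lp_norm p S f / Lp_norm p (ball 0 1) f
    \<le> M / m / (b ^ CARD('n) - a ^ CARD('n)) powr (1 / p)"
proof -
  have [measurable]: "ball (0::real^'n) s \<in> sets borel" for s by simp
  define g where "g = (\<lambda>x. ennreal (\<bar>y x\<bar> powr p))"
  have g [measurable]: "g \<in> borel_measurable borel" unfolding g_def by measurable
  define C where "C = (\<integral>\<^sup>+x\<in>ball 0 1. g x \<partial>lborel)"
  define N where "N = (\<integral>\<^sup>+ x\<in>S. ennreal (\<bar>f x\<bar> powr p) \<partial>lborel)"
  define D where "D = (\<integral>\<^sup>+ x\<in>ball 0 1. ennreal (\<bar>f x\<bar> powr p) \<partial>lborel)"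
  define V where "V = b ^ CARD('n) - a ^ CARD('n)"
  have V: "0 < V" using ab by (simp add: V_def power_strict_mono)
  have "C \<le> (\<integral>\<^sup>+x. ennreal (B powr p) * indicator (ball 0 1) (x::real^'n) \<partial>lborel)"
    unfolding C_def g_def
    by (intro nn_integral_mono mult_right_mono ennreal_leI powr_mono2) (use p bdd in auto)
  also have "\<dots> = ennreal (B powr p) * emeasure lborel (ball (0::real^'n) 1)"
    by (simp add: nn_integral_cmult_indicator)
  also have "\<dots> < \<infinity>"
    using emeasure_bounded_finite[of "ball (0::real^'n) 1"] by (simp add: ennreal_mult_less_top)
  finally have C: "C < \<infinity>" .
  have fp: "ennreal (\<bar>f x\<bar> powr p) = ennreal (\<bar>R (norm x)\<bar> powr p) * g x" for x
    unfolding g_def f by (simp add: abs_mult powr_mult flip: ennreal_mult)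
  have "N \<le> (\<integral>\<^sup>+x. ennreal (M powr p) * (g x * indicator (ball 0 1) x) \<partial>lborel)"
    unfolding N_def
  proof (rule nn_integral_mono)
    fix x
    have "ennreal (\<bar>R (norm x)\<bar> powr p) \<le> ennreal (M powr p)" if "x \<in> S"
      using M(2)[OF that] p by (intro ennreal_leI powr_mono2) auto
    then show "ennreal (\<bar>f x\<bar> powr p) * indicator S x \<le> ennreal (M powr p) * (g x * indicator (ball 0 1) x)"
      unfolding fp using S by (auto simp: indicator_def intro!: mult_right_mono)
  qed
  also have "\<dots> = ennreal (M powr p) * C"
    unfolding C_def by (rule nn_integral_cmult) measurable
  finally have N: "N \<le> ennreal (M powr p) * C" .
  have "ennreal (m powr p) * (ennreal V * C)
      = ennreal (m powr p) * (\<integral>\<^sup>+x\<in>ball 0 b - ball 0 a. g x \<partial>lborel)"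
    unfolding V_def C_def
    using nn_integral_annulus_homogeneous[of g a b] C ab hom by (simp add: C_def g_def)
  also have "\<dots> = (\<integral>\<^sup>+x. ennreal (m powr p) * (g x * indicator (ball 0 b - ball 0 a) x) \<partial>lborel)"
    by (rule nn_integral_cmult[symmetric]) measurable
  also have "\<dots> \<le> D"
    unfolding D_def
  proof (rule nn_integral_mono)
    fix x :: "real^'n"
    have "ennreal (m powr p) \<le> ennreal (\<bar>R (norm x)\<bar> powr p)" if "a \<le> norm x" "norm x < b"
      using m(1) m(2)[OF that] p by (intro ennreal_leI powr_mono2) auto
    then show "ennreal (m powr p) * (g x * indicator (ball 0 b - ball 0 a) x)
        \<le> ennreal (\<bar>f x\<bar> powr p) * indicator (ball 0 1) x"
      unfolding fp using ab by (auto simp: indicator_def intro!: mult_right_mono)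
  qed
  finally have D: "ennreal (m powr p) * (ennreal V * C) \<le> D" .
  have rhs: "0 \<le> M / m / V powr (1 / p)" using M(1) m(1) by simp
  define c where "c = enn2real C"
  have c: "0 \<le> c" "C = ennreal c" using C by (auto simp: c_def less_top)
  show ?thesis
  \<comment> \<open>In the degenerate cases the quotient is 0: \<open>enn2real\<close> sends
    \<open>\<infinity>\<close> to 0 and division by 0 yields 0, while \<open>c = 0\<close> makes the
    numerator vanish.\<close>
  proof (cases "D = \<infinity> \<or> c = 0")
    case True
    then have "enn2real N = 0 \<or> enn2real D = 0" using N c by auto
    then have "Lp_norm p S f / Lp_norm p (ball 0 1) f = 0"
      unfolding Lp_norm_def N_def[symmetric] D_def[symmetric] by auto
    then show ?thesis using rhs unfolding V_def by (simp only:)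
  next
    case False
    then have c0: "0 < c" using c by simp
    have "N \<le> ennreal (M powr p * c)" using N c by (simp add: ennreal_mult)
    then have N': "enn2real N \<le> M powr p * c" using c by (simp add: enn2real_leI)
    have "ennreal (m powr p * V * c) \<le> D"
      using D c V by (simp add: ennreal_mult mult.assoc)
    then have D': "m powr p * V * c \<le> enn2real D"
      using False c V enn2real_mono[of "ennreal (m powr p * V * c)" D] by (simp add: less_top)
    have 1: "Lp_norm p S f \<le> (M powr p * c) powr (1 / p)"
      unfolding Lp_norm_def N_def[symmetric] using N' p by (intro powr_mono2) auto
    have 2: "(m powr p * V * c) powr (1 / p) \<le> Lp_norm p (ball 0 1) f"
      unfolding Lp_norm_def D_def[symmetric] using D' p V c by (intro powr_mono2) auto
    have 3: "0 < (m powr p * V * c) powr (1 / p)" using m V c0 by simp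
    have "Lp_norm p S f / Lp_norm p (ball 0 1) f
        \<le> (M powr p * c) powr (1 / p) / (m powr p * V * c) powr (1 / p)"
      using 1 2 3 by (intro frac_le) auto
    also have "\<dots> = M / m / V powr (1 / p)"
      using m M V c0 p by (simp add: powr_mult powr_powr)
    finally show ?thesis by (simp add: V_def)
  qed
qed

lemma continuous_on_poly_fun: "continuous_on A (poly_fun c)"
  unfolding poly_fun_def[abs_def] by (intro continuous_intros)

text \<open>\<open>Y\<close> is arbitrary off the sphere, so measurability and boundedness are taken
  from the polynomial that represents it.\<close>

lemma sph_harm_radial_extension:
  assumes "Y \<in> sph_harm l"
  obtains y B where "y \<in> borel_measurable borel" "\<And>t x. 0 < t \<Longrightarrow> y (t *\<^sub>R x) = y x"
    "\<And>x. \<bar>y x\<bar> \<le> B" "\<And>x. x \<noteq> 0 \<Longrightarrow> y x = Y (x /\<^sub>R norm x)"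
proof -
  obtain c where c: "\<And>x. x \<in> sphere 0 1 \<Longrightarrow> Y x = poly_fun c x"
    using assms unfolding sph_harm_def by blast
  define y where "y = (\<lambda>x::real^'a. poly_fun c (x /\<^sub>R norm x))"
  have [measurable]: "poly_fun c \<in> borel_measurable borel"
    by (intro borel_measurable_continuous_onI continuous_on_poly_fun)
  \<comment> \<open>The whole ball is used since \<open>x /\<^sub>R norm x\<close> is 0 at the
    origin.\<close>
  have "bounded (poly_fun c ` cball 0 1)"
    by (intro compact_imp_bounded compact_continuous_image continuous_on_poly_fun compact_cball)
  then obtain B where B: "\<And>x. x \<in> cball 0 1 \<Longrightarrow> \<bar>poly_fun c x\<bar> \<le> B"
    unfolding bounded_iff real_norm_def by blast
  show ?thesis
  proof (rule that)
    show "y \<in> borel_measurable borel" unfolding y_def by measurable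
    show "y (t *\<^sub>R x) = y x" if "0 < t" for t x
      using that by (simp add: y_def field_simps)
    show "\<bar>y x\<bar> \<le> B" for x
      unfolding y_def by (rule B) (cases "x = 0"; simp)
    show "y x = Y (x /\<^sub>R norm x)" if "x \<noteq> 0" for x
      unfolding y_def by (rule c[symmetric]) (use that in simp)
  qed
qed

subsection \<open>Eigenfunctions of the unit ball\<close>

text \<open>The increasing map from \<open>s\<close> to \<open>\<nu> * exp s\<close> matches the
  zeros and preserves the counts, so existence and uniqueness carry over to the definite
  description.\<close>

lemma bessel_zero_log:
  assumes nu: "0 < \<nu>" and k: "1 \<le> k"
  obtains s where "bessel_zero \<nu> k = \<nu> * exp s" "besselJ_log \<nu> s = 0"
    "card {y. y < s \<and> besselJ_log \<nu> y = 0} = k - 1"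
proof -
  interpret turning_point \<nu> "besselJ_log \<nu>" "besselJ_log' \<nu>"
    by (rule turning_point_besselJ_log[OF nu])
  obtain s where s: "besselJ_log \<nu> s = 0" "card {y. y < s \<and> besselJ_log \<nu> y = 0} = k - 1"
    using kth_zero_exists by blast
  have card: "card {y. 0 < y \<and> y < \<nu> * exp t \<and> besselJ \<nu> y = 0} = card {y. y < t \<and> besselJ_log \<nu> y = 0}" for t
  proof -
    have "{y. 0 < y \<and> y < \<nu> * exp t \<and> besselJ \<nu> y = 0} = (\<lambda>y. \<nu> * exp y) ` {y. y < t \<and> besselJ_log \<nu> y = 0}"
    proof (intro equalityI subsetI)
      fix y assume y: "y \<in> {y. 0 < y \<and> y < \<nu> * exp t \<and> besselJ \<nu> y = 0}"
      then have e: "y = \<nu> * exp (ln (y / \<nu>))" using nu by simp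
      then have "exp (ln (y / \<nu>)) < exp t" using y nu by (metis mem_Collect_eq mult_less_cancel_left_pos)
      then have "ln (y / \<nu>) < t" by simp
      then show "y \<in> (\<lambda>y. \<nu> * exp y) ` {y. y < t \<and> besselJ_log \<nu> y = 0}"
        using y e by (intro image_eqI[of _ _ "ln (y / \<nu>)"]) (auto simp: besselJ_log_def)
    qed (use nu in \<open>auto simp: besselJ_log_def\<close>)
    moreover have "inj_on (\<lambda>y. \<nu> * exp y) A" for A using nu by (auto simp: inj_on_def)
    ultimately show ?thesis by (simp add: card_image)
  qed
  have "bessel_zero \<nu> k = \<nu> * exp s"
    unfolding bessel_zero_def
  proof (rule the_equality)
    show "0 < \<nu> * exp s \<and> besselJ \<nu> (\<nu> * exp s) = 0 \<and>
        card {y. 0 < y \<and> y < \<nu> * exp s \<and> besselJ \<nu> y = 0} = k - 1"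
      using nu s unfolding card by (simp add: besselJ_log_def)
  next
    fix z assume z: "0 < z \<and> besselJ \<nu> z = 0 \<and> card {y. 0 < y \<and> y < z \<and> besselJ \<nu> y = 0} = k - 1"
    have e: "z = \<nu> * exp (ln (z / \<nu>))" using z nu by simp
    have "ln (z / \<nu>) = s"
    proof (rule kth_zero_unique)
      show "besselJ_log \<nu> (ln (z / \<nu>)) = 0" using z e by (simp add: besselJ_log_def)
      show "card {y. y < ln (z / \<nu>) \<and> besselJ_log \<nu> y = 0} = card {y. y < s \<and> besselJ_log \<nu> y = 0}"
        unfolding card[symmetric] e[symmetric] using z s card by simp
    qed (rule s)
    then show "z = \<nu> * exp s" using e by simp
  qed
  then show ?thesis using that s by blast
qed

section \<open>Asymptotics of the order\<close>

lemma nu_l_asymp: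
  assumes "filterlim l at_top sequentially"
  shows "(\<lambda>n. nu_l c d (l n) / real (l n)) \<longlonglongrightarrow> 1"
proof -
  have L: "filterlim (\<lambda>n. real (l n)) at_top sequentially"
    by (rule filterlim_compose[OF filterlim_real_sequentially assms])
  have lim0: "(\<lambda>n. a / real (l n)) \<longlonglongrightarrow> 0" for a :: real
    using tendsto_divide_0[OF tendsto_const filterlim_at_top_imp_at_infinity[OF L]] .
  have "(\<lambda>n. sqrt ((1 + (real d / 2 - 1) / real (l n))\<^sup>2 + (c / real (l n))\<^sup>2)) \<longlonglongrightarrow> sqrt ((1 + 0)\<^sup>2 + 0\<^sup>2)"
    by (intro tendsto_intros lim0)
  then have "(\<lambda>n. sqrt ((1 + (real d / 2 - 1) / real (l n))\<^sup>2 + (c / real (l n))\<^sup>2)) \<longlonglongrightarrow> 1" by simp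
  moreover have "eventually (\<lambda>n. sqrt ((1 + (real d / 2 - 1) / real (l n))\<^sup>2 + (c / real (l n))\<^sup>2)
      = nu_l c d (l n) / real (l n)) sequentially"
    using filterlim_at_top_dense[THEN iffD1, OF L, rule_format, of 0]
  proof eventually_elim
    case (elim n)
    have "1 + (real d / 2 - 1) / real (l n) = (real (l n) + real d / 2 - 1) / real (l n)"
      using elim by (simp add: field_simps)
    then have "(1 + (real d / 2 - 1) / real (l n))\<^sup>2 + (c / real (l n))\<^sup>2
        = ((real (l n) + real d / 2 - 1)\<^sup>2 + c\<^sup>2) / (real (l n))\<^sup>2"
      by (simp only: power_divide add_divide_distrib)
    then show ?case using elim by (simp add: nu_l_def real_sqrt_divide)
  qed
  ultimately show ?thesis by (rule Lim_transform_eventually)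
qed

lemma nu_l_at_top:
  assumes "filterlim l at_top sequentially"
  shows "filterlim (\<lambda>n. nu_l c d (l n)) at_top sequentially"
proof -
  have L: "filterlim (\<lambda>n. real (l n)) at_top sequentially"
    by (rule filterlim_compose[OF filterlim_real_sequentially assms])
  have "filterlim (\<lambda>n. nu_l c d (l n) / real (l n) * real (l n)) at_top sequentially"
    by (rule filterlim_tendsto_pos_mult_at_top[OF nu_l_asymp[OF assms] _ L]) simp
  moreover have "eventually (\<lambda>n. nu_l c d (l n) / real (l n) * real (l n) = nu_l c d (l n)) sequentially"
    using filterlim_at_top_dense[THEN iffD1, OF L, rule_format, of 0] by eventually_elim simp
  ultimately show ?thesis by (simp add: filterlim_cong)
qed

section \<open>Bounds at a fixed distance from the turning point\<close>

context turning_point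
begin

lemma outer_bound:
  assumes h: "0 < h" "\<nu>\<^sup>2 * h ^ 3 = 1" "h \<le> 1" and d: "h \<le> \<delta>" "\<delta> \<le> s"
  shows "\<bar>v s\<bar> \<le> sqrt (294 / sqrt (exp (2 * \<delta>) - 1)) * sqrt (sqrt h) * v 0"
proof -
  have q: "0 < sqrt (exp (2 * \<delta>) - 1)" using h d by simp
  have "sqrt (exp (2 * \<delta>) - 1) * (v s)\<^sup>2 \<le> sqrt (exp (2 * s) - 1) * (v s)\<^sup>2"
    using d by (intro mult_right_mono) auto
  also have "\<dots> \<le> 294 * sqrt h * (v 0)\<^sup>2"
    using h d by (intro v_upper[of h]) auto
  finally have "(v s)\<^sup>2 \<le> 294 / sqrt (exp (2 * \<delta>) - 1) * sqrt h * (v 0)\<^sup>2"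
    using q by (simp add: field_simps)
  then have le: "sqrt ((v s)\<^sup>2) \<le> sqrt (294 / sqrt (exp (2 * \<delta>) - 1) * sqrt h * (v 0)\<^sup>2)"
    by (rule real_sqrt_le_mono)
  show ?thesis using le[unfolded real_sqrt_mult] v_pos[of 0] by simp
qed

text \<open>\<open>v_decay\<close> gains a factor \<open>1 / \<nu> = h powr (3/2)\<close>. It is
  weakened to \<open>h powr (1/4)\<close> to match \<open>outer_bound\<close>.\<close>

lemma inner_bound:
  assumes h: "0 < h" "\<nu>\<^sup>2 * h ^ 3 = 1" "h \<le> 1"
    and d: "0 < \<delta>" "b \<le> \<nu> * sqrt (1 - exp (- 2 * \<delta>))" "s \<le> - \<delta>"
  shows "exp (- b * s) * v s \<le> exp (b * \<delta>) / (\<delta> * sqrt (1 - exp (- 2 * \<delta>))) * sqrt (sqrt h) * v 0"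
proof -
  define \<kappa> where "\<kappa> = sqrt (1 - exp (- 2 * \<delta>))"
  have k: "0 < \<kappa>" using d by (simp add: \<kappa>_def)
  have nu1: "1 / \<nu> \<le> sqrt (sqrt h)"
  proof -
    have "1 / \<nu> = sqrt (1 / \<nu>\<^sup>2)" using nu_pos by (simp add: real_sqrt_divide)
    also have "1 / \<nu>\<^sup>2 = h ^ 3" using h nu_pos by (simp add: field_simps)
    also have "sqrt (h ^ 3) \<le> sqrt (sqrt h)"
      using h by (intro real_sqrt_le_mono real_le_rsqrt)
        (use power_decreasing[of 1 6 h] in \<open>simp flip: power_mult\<close>)
    finally show ?thesis .
  qed
  have "v (-\<delta>) * (\<delta> * \<nu> * \<kappa>) \<le> v (-\<delta>) * (1 + \<delta> * \<nu> * \<kappa>)"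
    using v_pos[of "-\<delta>"] d by (intro mult_left_mono) auto
  also have "\<dots> \<le> v 0" unfolding \<kappa>_def using d by (intro v_decay) simp
  finally have "v (-\<delta>) \<le> v 0 / (\<delta> * \<kappa>) * (1 / \<nu>)"
    using d k nu_pos by (simp add: field_simps)
  also have "\<dots> \<le> v 0 / (\<delta> * \<kappa>) * sqrt (sqrt h)"
    using nu1 d k v_pos[of 0] by (intro mult_left_mono) auto
  finally have "exp (b * \<delta>) * v (-\<delta>) \<le> exp (b * \<delta>) * (v 0 / (\<delta> * \<kappa>) * sqrt (sqrt h))"
    by (rule mult_left_mono) simp
  moreover have "exp (- b * s) * v s \<le> exp (b * \<delta>) * v (-\<delta>)"
    using d by (intro weighted_v_mono) auto
  ultimately show ?thesis by (simp add: \<kappa>_def mult_ac)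
qed

end

text \<open>Passes from distance in the radius to distance in its logarithm. Of the margin
  \<open>2 * \<delta>\<close>, one \<open>\<delta>\<close> will be spent on the difference between
  the actual and the limiting turning point.\<close>

lemma radius_neighbourhood:
  fixes r \<epsilon> :: real
  assumes "0 < r" "0 < \<epsilon>"
  obtains \<delta> where "0 < \<delta>" "r * exp (2 * \<delta>) \<le> r + \<epsilon>" "r - \<epsilon> \<le> r * exp (- 2 * \<delta>)"
proof
  define x where "x = 1 + \<epsilon> / r"
  have x: "1 < x" using assms by (simp add: x_def)
  then have e: "exp (2 * (ln x / 2)) = x" by simp
  show "0 < ln x / 2" using x by simp
  show "r * exp (2 * (ln x / 2)) \<le> r + \<epsilon>"
    unfolding e x_def using assms by (simp add: field_simps)
  have e': "exp (- 2 * (ln x / 2)) = 1 / x" using x by (simp add: exp_minus inverse_eq_divide)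
  have "(r - \<epsilon>) * x \<le> r"
    using assms by (simp add: x_def field_simps)
  then show "r - \<epsilon> \<le> r * exp (- 2 * (ln x / 2))"
    unfolding e' using x by (simp add: field_simps)
qed

lemma one_minus_exp_ge:
  fixes x :: real
  assumes "0 \<le> x" "x \<le> 1" shows "x / 2 \<le> 1 - exp (- x)"
proof -
  have "exp (-x) \<le> 1 / (1 + x)"
    using exp_ge_add_one_self[of x] assms by (simp add: exp_minus field_simps)
  also have "\<dots> \<le> 1 - x / 2"
    using assms mult_left_mono[of x 1 x] by (simp add: field_simps)
  finally show ?thesis by simp
qed

text \<open>The turning point of the eigenfunction has radius \<open>exp (- z)\<close>, with
  \<open>S\<close> the limit of \<open>z\<close>. The exponent \<open>1 / 4\<close> comes from the
  bounds away from the turning point, \<open>1 / p\<close> from the volume of order \<open>h\<close>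
  of an annulus where the radial part is at least \<open>v 0 / 2\<close>. All other factors are free
  of \<open>k\<close> and \<open>l\<close>.\<close>

lemma u_eig_ratio_le:
  fixes Y :: "real^'n::finite \<Rightarrow> real" and k l :: nat and c :: real
  defines "\<nu> \<equiv> nu_l c CARD('n) l" and "b \<equiv> real CARD('n) / 2 - 1"
  assumes card: "2 \<le> CARD('n)" and p: "0 < p" and Y: "Y \<in> sph_harm l"
    and nu: "0 < \<nu>" and h: "0 < h" "\<nu>\<^sup>2 * h ^ 3 = 1" "h \<le> 1" "h \<le> \<delta>"
    and z: "bessel_zero \<nu> k = \<nu> * exp z" "0 < z" "\<bar>z - S\<bar> \<le> \<delta>" "z \<le> S + 1"
    and d: "0 < \<delta>" "exp (- S) * exp (2 * \<delta>) \<le> exp (- S) + \<epsilon>" "exp (- S) - \<epsilon> \<le> exp (- S) * exp (- 2 * \<delta>)"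
    and b: "b \<le> \<nu> * sqrt (1 - exp (- 2 * \<delta>))"
  shows "Lp_norm p (Dset (exp (- S)) \<epsilon> \<inter> ball 0 1) (u_eig c k l Y)
      / Lp_norm p (ball 0 1) (u_eig c k l Y)
    \<le> 2 * (exp (b * S) * sqrt (294 / sqrt (exp (2 * \<delta>) - 1))
          + exp (b * (S + 1)) * (exp (b * \<delta>) / (\<delta> * sqrt (1 - exp (- 2 * \<delta>)))))
      / (exp (- real CARD('n) * (S + 1)) / 12) powr (1 / p) * h powr (1 / 4 - 1 / p)"
proof -
  interpret turning_point \<nu> "besselJ_log \<nu>" "besselJ_log' \<nu>"
    by (rule turning_point_besselJ_log[OF nu])
  obtain y B where y: "y \<in> borel_measurable borel" "\<And>t x. 0 < t \<Longrightarrow> y (t *\<^sub>R x) = y x"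
    "\<And>x. \<bar>y x\<bar> \<le> B" "\<And>x. x \<noteq> 0 \<Longrightarrow> y x = Y (x /\<^sub>R norm x)"
    using sph_harm_radial_extension[OF Y] by blast
  define v where "v = besselJ_log \<nu>"
  define R where "R = (\<lambda>r. r powr (1 - real CARD('n) / 2) * besselJ \<nu> (bessel_zero \<nu> k * r))"
  define A1 where "A1 = exp (b * S) * sqrt (294 / sqrt (exp (2 * \<delta>) - 1))"
  define A2 where "A2 = exp (b * (S + 1)) * (exp (b * \<delta>) / (\<delta> * sqrt (1 - exp (- 2 * \<delta>))))"
  have A: "0 \<le> A1" "0 \<le> A2" using d by (auto simp: A1_def A2_def)
  have b0: "0 \<le> b" using card by (simp add: b_def)
  have v0: "0 < v 0" using v_pos[of 0] by (simp add: v_def)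
  have R: "R r = exp (- b * ln r) * v (z + ln r)" if "0 < r" for r
    using that by (simp add: R_def v_def besselJ_log_def z(1) powr_def b_def exp_add mult.assoc)
  define M where "M = (A1 + A2) * sqrt (sqrt h) * v 0"
  have q0: "0 \<le> sqrt (sqrt h) * v 0" using h v0 by simp
  have M1: "A1 * sqrt (sqrt h) * v 0 \<le> M" and M2: "A2 * sqrt (sqrt h) * v 0 \<le> M"
    unfolding M_def using A q0 by (auto simp: mult.assoc intro!: mult_right_mono)
  have M0: "0 \<le> M" unfolding M_def using A q0 by (simp add: mult.assoc)
  have Mbound: "\<bar>R (norm x)\<bar> \<le> M" if x: "x \<in> Dset (exp (- S)) \<epsilon> \<inter> ball 0 1" for x :: "real^'n"
  proof (cases "x = 0")
    \<comment> \<open>At the origin \<open>R\<close> vanishes because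
      \<open>0 powr a = 0\<close>.\<close>
    case True
    then show ?thesis using M0 by (simp add: R_def)
  next
    case False
    define r where "r = norm x"
    have r: "0 < r" "r < 1" "\<epsilon> \<le> \<bar>r - exp (-S)\<bar>"
      using x False by (auto simp: r_def Dset_def)
    then consider "exp (- S) * exp (2 * \<delta>) \<le> r" | "r \<le> exp (- S) * exp (- 2 * \<delta>)"
      using d by linarith
    then have "\<bar>R r\<bar> \<le> M"
    proof cases
      case 1
      then have "exp (- S + 2 * \<delta>) \<le> exp (ln r)" using r by (simp only: exp_add exp_ln)
      then have lr: "- S + 2 * \<delta> \<le> ln r" by simp
      have s: "\<delta> \<le> z + ln r" using lr z(3) by linarith
      have "\<bar>R r\<bar> = exp (- b * ln r) * \<bar>v (z + ln r)\<bar>" using R[OF r(1)] by (simp add: abs_mult)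
      also have "\<dots> \<le> exp (b * S) * (sqrt (294 / sqrt (exp (2 * \<delta>) - 1)) * sqrt (sqrt h) * v 0)"
      proof (rule mult_mono)
        have "b * (- ln r) \<le> b * S" using lr d b0 by (intro mult_left_mono) auto
        then show "exp (- b * ln r) \<le> exp (b * S)" by simp
        show "\<bar>v (z + ln r)\<bar> \<le> sqrt (294 / sqrt (exp (2 * \<delta>) - 1)) * sqrt (sqrt h) * v 0"
          unfolding v_def by (rule outer_bound) (use h s in auto)
      qed auto
      also have "\<dots> \<le> M" using M1 by (simp add: A1_def mult.assoc)
      finally show ?thesis .
    next
      case 2
      then have "exp (ln r) \<le> exp (- S + - 2 * \<delta>)" using r by (simp only: exp_add exp_ln)
      then have lr: "ln r \<le> - S - 2 * \<delta>" by simp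
      define s where "s = z + ln r"
      have s: "s \<le> - \<delta>" unfolding s_def using lr z(3) by linarith
      have "0 < v s" unfolding v_def using s d by (intro v_pos) simp
      have "R r = exp (- b * ln r) * v s" using R[OF r(1)] by (simp add: s_def)
      \<comment> \<open>With \<open>ln r = s - z\<close> the factor singular at the origin joins
        \<open>v s\<close>, as \<open>inner_bound\<close> expects.\<close>
      also have "\<dots> = exp (b * z) * (exp (- b * s) * v s)"
        by (simp add: s_def algebra_simps flip: exp_add)
      finally have Rs: "R r = exp (b * z) * (exp (- b * s) * v s)" .
      then have "\<bar>R r\<bar> = exp (b * z) * (exp (- b * s) * v s)" using \<open>0 < v s\<close> by simp
      also have "\<dots> \<le> exp (b * (S + 1)) *
          (exp (b * \<delta>) / (\<delta> * sqrt (1 - exp (- 2 * \<delta>))) * sqrt (sqrt h) * v 0)"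
      proof (rule mult_mono)
        show "exp (b * z) \<le> exp (b * (S + 1))" using z b0 by (simp add: mult_left_mono)
        show "exp (- b * s) * v s \<le> exp (b * \<delta>) / (\<delta> * sqrt (1 - exp (- 2 * \<delta>))) * sqrt (sqrt h) * v 0"
          unfolding v_def by (rule inner_bound) (use h d s b in auto)
      qed (use \<open>0 < v s\<close> in auto)
      also have "\<dots> \<le> M" using M2 by (simp add: A2_def mult.assoc)
      finally show ?thesis .
    qed
    then show ?thesis by (simp add: r_def)
  qed
  \<comment> \<open>These radii correspond to \<open>s = - h / 6\<close> and \<open>s = 0\<close>,
    the range of \<open>v_lower\<close>.\<close>
  define \<alpha> where "\<alpha> = exp (- z - h / 6)"
  define \<beta> where "\<beta> = exp (- z)"
  have m: "v 0 / 2 \<le> \<bar>R r\<bar>" if r: "\<alpha> \<le> r" "r < \<beta>" for r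
  proof -
    have r0: "0 < r" using r(1) exp_gt_zero[of "- z - h / 6"] unfolding \<alpha>_def by linarith
    have l1: "- z - h / 6 \<le> ln r" using r r0 by (simp add: \<alpha>_def ln_ge_iff)
    have "exp (ln r) < exp (- z)" using r r0 by (simp add: \<beta>_def)
    then have l2: "ln r < - z" by simp
    have 1: "v 0 / 2 \<le> v (z + ln r)"
      unfolding v_def by (rule v_lower[of h]) (use h l1 l2 in auto)
    have "b * ln r \<le> 0" using b0 l2 z by (intro mult_nonneg_nonpos) auto
    then have "1 \<le> exp (- b * ln r)" by simp
    then have "1 * v (z + ln r) \<le> exp (- b * ln r) * v (z + ln r)"
      using 1 v0 by (intro mult_right_mono) auto
    then show ?thesis unfolding R[OF r0] using 1 by linarith
  qed
  have ab: "0 < \<alpha>" "\<alpha> < \<beta>" "\<beta> \<le> 1" using h z by (auto simp: \<alpha>_def \<beta>_def)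
  have "Lp_norm p (Dset (exp (- S)) \<epsilon> \<inter> ball 0 1) (u_eig c k l Y)
      / Lp_norm p (ball 0 1) (u_eig c k l Y)
    \<le> M / (v 0 / 2) / (\<beta> ^ CARD('n) - \<alpha> ^ CARD('n)) powr (1 / p)"
  proof (rule Lp_norm_ratio_le[where R = R and y = y and B = B])
    show "u_eig c k l Y x = R (norm x) * y x" for x
      using y(4)[of x] by (cases "x = 0") (simp_all add: u_eig_def R_def \<nu>_def Let_def)
  qed (use p y(1-3) M0 Mbound v0 m ab in auto)
  also have "\<dots> \<le> M / (v 0 / 2) / (exp (- real CARD('n) * (S + 1)) / 12 * h) powr (1 / p)"
  proof (intro divide_left_mono powr_mono2)
    have "\<beta> ^ CARD('n) - \<alpha> ^ CARD('n) = exp (- real CARD('n) * z) * (1 - exp (- (real CARD('n) * h / 6)))"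
      by (simp add: \<alpha>_def \<beta>_def algebra_simps flip: exp_of_nat_mult exp_add)
    \<comment> \<open>The estimate \<open>1 - exp (- h / 6) \<ge> h / 12\<close> provides the 12,
      and \<open>z \<le> S + 1\<close> removes the dependence on \<open>z\<close>.\<close>
    moreover have "exp (- real CARD('n) * (S + 1)) * (h / 12) \<le> \<dots>"
    proof (rule mult_mono)
      show "exp (- real CARD('n) * (S + 1)) \<le> exp (- real CARD('n) * z)" using z by simp
      have "h / 12 \<le> 1 - exp (- (h / 6))" using one_minus_exp_ge[of "h / 6"] h by simp
      also have "h / 6 \<le> real CARD('n) * h / 6" using h card by simp
      then have "1 - exp (- (h / 6)) \<le> 1 - exp (- (real CARD('n) * h / 6))" by simp
      finally show "h / 12 \<le> 1 - exp (- (real CARD('n) * h / 6))" .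
    qed (use h in auto)
    ultimately show "exp (- real CARD('n) * (S + 1)) / 12 * h \<le> \<beta> ^ CARD('n) - \<alpha> ^ CARD('n)"
      by simp
    have "\<alpha> ^ CARD('n) < \<beta> ^ CARD('n)" using ab by (intro power_strict_mono) auto
    then show "0 < (\<beta> ^ CARD('n) - \<alpha> ^ CARD('n)) powr (1 / p) * (exp (- real CARD('n) * (S + 1)) / 12 * h) powr (1 / p)"
      using h by simp
  qed (use p h M0 v0 in auto)
  also have "\<dots> = 2 * (A1 + A2) / (exp (- real CARD('n) * (S + 1)) / 12) powr (1 / p) * h powr (1 / 4 - 1 / p)"
  proof -
    have "sqrt (sqrt h) = h powr (1 / 4)"
      using h by (simp add: powr_half_sqrt[symmetric] powr_powr)
    then have "M / (v 0 / 2) = 2 * (A1 + A2) * h powr (1 / 4)"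
      using v0 by (simp add: M_def)
    moreover have "(exp (- real CARD('n) * (S + 1)) / 12 * h) powr (1 / p)
        = (exp (- real CARD('n) * (S + 1)) / 12) powr (1 / p) * h powr (1 / p)"
      by (rule powr_mult)
    ultimately show ?thesis by (simp only: powr_diff times_divide_times_eq divide_divide_eq_left)
  qed
  finally show ?thesis unfolding A1_def A2_def .
qed

theorem theorem2p3:
  fixes c \<epsilon> p w :: real
    and l k :: "nat \<Rightarrow> nat"
    and Y :: "nat \<Rightarrow> real^'n::finite \<Rightarrow> real"
  assumes "CARD('n) \<ge> 2" and "c \<ge> 0"
    and "\<epsilon> > 0" and "p > 4" and "w > 0"
    and "filterlim l at_top sequentially" and "filterlim k at_top sequentially"
    and "(\<lambda>n. real (l n) / real (k n)) \<longlonglongrightarrow> w"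
    and "\<And>n. Y n \<in> sph_harm (l n)"
    and "\<And>n. \<exists>\<xi>\<in>sphere 0 1. Y n \<xi> \<noteq> 0"
  shows "(\<lambda>n. Lp_norm p (Dset (1 / hfun w) \<epsilon> \<inter> ball 0 1) (u_eig c (k n) (l n) (Y n))
             / Lp_norm p (ball 0 1) (u_eig c (k n) (l n) (Y n))) \<longlonglongrightarrow> 0"
proof -
  define \<nu> where "\<nu> = (\<lambda>n. nu_l c CARD('n) (l n))"
  define b where "b = real CARD('n) / 2 - 1"
  have nu_top: "filterlim \<nu> at_top sequentially"
    unfolding \<nu>_def by (rule nu_l_at_top[OF assms(6)])
  have nu_ev: "eventually (\<lambda>n. C < \<nu> n) sequentially" for C
    using nu_top by (simp add: filterlim_at_top_dense)
  have k_ev: "eventually (\<lambda>n. 1 \<le> k n) sequentially"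
    using assms(7) by (simp add: filterlim_at_top)
  obtain S where S: "0 < S" "wkb_phase S = pi / w"
    using wkb_phase_surj[of "pi / w"] assms(5) by auto
  have hf: "1 / hfun w = exp (- S)"
    using hfun_eq[OF assms(5) S] by (simp add: exp_minus field_simps)
  \<comment> \<open>The guard holds for all but finitely many \<open>n\<close>; elsewhere the chosen
    \<open>z n\<close> is arbitrary.\<close>
  have "\<exists>z. 0 < \<nu> n \<and> 1 \<le> k n \<longrightarrow> bessel_zero (\<nu> n) (k n) = \<nu> n * exp z \<and> besselJ_log (\<nu> n) z = 0 \<and>
      card {y. y < z \<and> besselJ_log (\<nu> n) y = 0} = k n - 1" for n
    using bessel_zero_log[of "\<nu> n" "k n"] by metis
  then obtain z where z: "\<And>n. 0 < \<nu> n \<and> 1 \<le> k n \<longrightarrow> bessel_zero (\<nu> n) (k n) = \<nu> n * exp (z n) \<and>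
      besselJ_log (\<nu> n) (z n) = 0 \<and> card {y. y < z n \<and> besselJ_log (\<nu> n) y = 0} = k n - 1"
    by metis
  have z_pos: "eventually (\<lambda>n. 0 < z n) sequentially"
    using nu_ev[of 0] k_ev
    by eventually_elim (use z turning_point.zero_pos[OF turning_point_besselJ_log] in blast)
  have z_lim: "z \<longlonglongrightarrow> S"
  proof (rule wkb_phase_inverse_tendsto[OF S(1) _ z_pos])
    \<comment> \<open>The factor \<open>k / \<nu>\<close> is the product of the reciprocals of
      \<open>l / k\<close> and \<open>\<nu> / l\<close>, whose limits are \<open>w\<close> and
      1.\<close>
    have "(\<lambda>n. inverse (real (l n) / real (k n)) * inverse (\<nu> n / real (l n)) * pi) \<longlonglongrightarrow> inverse w * inverse 1 * pi"
      unfolding \<nu>_def using assms(5) by (intro tendsto_intros assms(8) nu_l_asymp assms(6)) auto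
    moreover have "eventually (\<lambda>n. inverse (real (l n) / real (k n)) * inverse (\<nu> n / real (l n)) * pi
        = real (k n) * pi / \<nu> n) sequentially"
      using assms(6)[unfolded filterlim_at_top, rule_format, of 1]
      by eventually_elim (simp add: field_simps)
    ultimately have "(\<lambda>n. real (k n) * pi / \<nu> n) \<longlonglongrightarrow> inverse w * inverse 1 * pi"
      by (rule Lim_transform_eventually)
    then have K: "(\<lambda>n. real (k n) * pi / \<nu> n) \<longlonglongrightarrow> wkb_phase S"
      using S by (simp add: field_simps)
    show "(\<lambda>n. wkb_phase (z n)) \<longlonglongrightarrow> wkb_phase S"
    proof (rule wkb_phase_tendsto[OF nu_top K z_pos])
      fix d :: real assume d: "0 < d"
      show "eventually (\<lambda>n. \<bar>real (k n) * pi / \<nu> n - wkb_phase (z n)\<bar> \<le> pi / \<nu> n +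
          (d + pi / (\<nu> n * sqrt (exp (2 * d) - 1))) * sqrt (exp (2 * z n) - 1)) sequentially"
        using nu_ev[of 0] k_ev
      proof eventually_elim
        case (elim n)
        interpret turning_point "\<nu> n" "besselJ_log (\<nu> n)" "besselJ_log' (\<nu> n)"
          by (rule turning_point_besselJ_log[OF elim(1)])
        show ?case using kth_zero_phase[OF d, of "z n" "k n - 1"] z[of n] elim by simp
      qed
    qed
  qed
  define h where "h = (\<lambda>n. \<nu> n powr (- 2 / 3))"
  have h_lim: "h \<longlonglongrightarrow> 0"
    unfolding h_def by (rule tendsto_neg_powr[OF _ nu_top]) simp
  obtain \<delta> where d: "0 < \<delta>" "exp (- S) * exp (2 * \<delta>) \<le> exp (- S) + \<epsilon>"
    "exp (- S) - \<epsilon> \<le> exp (- S) * exp (- 2 * \<delta>)"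
    using radius_neighbourhood[of "exp (- S)" \<epsilon>] assms(3) by auto
  define \<kappa> where "\<kappa> = sqrt (1 - exp (- 2 * \<delta>))"
  have k0: "0 < \<kappa>" using d by (simp add: \<kappa>_def)
  define K where "K = 2 * (exp (b * S) * sqrt (294 / sqrt (exp (2 * \<delta>) - 1))
          + exp (b * (S + 1)) * (exp (b * \<delta>) / (\<delta> * sqrt (1 - exp (- 2 * \<delta>)))))
      / (exp (- real CARD('n) * (S + 1)) / 12) powr (1 / p)"
  let ?ratio = "\<lambda>n. Lp_norm p (Dset (1 / hfun w) \<epsilon> \<inter> ball 0 1) (u_eig c (k n) (l n) (Y n))
             / Lp_norm p (ball 0 1) (u_eig c (k n) (l n) (Y n))"
  have z_near: "eventually (\<lambda>n. \<bar>z n - S\<bar> < e) sequentially" if "0 < e" for e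
    using tendstoD[OF z_lim that] by (simp add: dist_real_def)
  \<comment> \<open>Since \<open>z\<close> tends to \<open>S\<close> and \<open>h\<close> to 0,
    every smallness condition of \<open>u_eig_ratio_le\<close> holds eventually, with the same
    constant \<open>K\<close> for all \<open>n\<close>.\<close>
  have ratio_le: "eventually (\<lambda>n. ?ratio n \<le> K * h n powr (1 / 4 - 1 / p)) sequentially"
    using nu_ev[of 0] nu_ev[of "b / \<kappa>"] k_ev z_pos z_near[OF zero_less_one] z_near[OF d(1)]
      order_tendstoD(2)[OF h_lim zero_less_one] order_tendstoD(2)[OF h_lim d(1)]
  proof eventually_elim
    case (elim n)
    have nu_eq: "nu_l c CARD('n) (l n) = \<nu> n" by (simp add: \<nu>_def)
    have "(\<nu> n)\<^sup>2 * (h n) ^ 3 = 1"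
    proof -
      have "(h n) ^ 3 = \<nu> n powr (- 2)"
        using elim(1) by (simp add: h_def powr_power)
      then show ?thesis using elim(1) by (simp add: powr_minus powr_numeral)
    qed
    moreover have "b \<le> \<nu> n * sqrt (1 - exp (- 2 * \<delta>))"
      using elim(2) k0 unfolding \<kappa>_def[symmetric] by (simp add: field_simps)
    ultimately show ?case
      unfolding hf K_def b_def
      using assms(1,4,9) elim d z[of n]
      by (intro u_eig_ratio_le[where z = "z n"]) (auto simp: nu_eq h_def)
  qed
  have "(\<lambda>n. h n powr (1 / 4 - 1 / p)) \<longlonglongrightarrow> 0"
  proof (rule tendsto_zero_powrI[OF h_lim tendsto_const])
    \<comment> \<open>This positivity is exactly the condition \<open>p > 4\<close>.\<close>
    show "0 < 1 / 4 - 1 / p" using assms(4) by (simp add: field_simps)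
  qed (simp_all add: h_def)
  then have "(\<lambda>n. K * h n powr (1 / 4 - 1 / p)) \<longlonglongrightarrow> 0"
    using tendsto_mult_left[of _ 0 sequentially K] by simp
  moreover have "0 \<le> ?ratio n" for n by (simp add: Lp_norm_def)
  ultimately show ?thesis
    using ratio_le by (intro tendsto_sandwich[OF _ ratio_le tendsto_const]) auto
qed

end
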